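(* Let $K\ge1$ be an integer. In the $K$-LFLP, the approximation ratio of the Canonical $K$-Chance Greedy Algorithm is at most $\Gamma_{\mathrm{SFR\text{-}K}}(K):=\inf_{n\in\mathbb{N}}\mathrm{Obj}(\mathcal{P}^{K}(n))$.
   Context: The $K$-location facility location problem ($K$-LFLP): an instance consists of locations $[n]$ with a metric $d$, facility opening costs $f_i\ge0$, and for each hyperedge $e=(e_1,\dots,e_K)\in E:=[n]^K$ a number $\tau_e\ge0$ of individuals associated with the locations $e_1,\dots,e_K$. Put $d(e,i)=\min_{L\in[K]}d(e_L,i)$ and $\mathrm{Cost}(\mathrm{SOL})=\sum_{i\in\mathrm{SOL}}f_i+\sum_{e\in E}\tau_e\min_{i\in\mathrm{SOL}}d(e,i)$; $\mathrm{OPT}$ is a cost minimizer. Approximation ratio at most $\Gamma$ means the output always costs at most $\Gamma\cdot\mathrm{Cost}(\mathrm{OPT})$. Canonical $K$-Chance Greedy Algorithm ($x^+=\max\{x,0\}$): it maintains $\mathrm{SOL}=\emptyset$, $\alpha(e)=0$, $U=E$, and $\psi(e,L)=\bot$ for $e\in E$, $L\in[K]$. Time runs continuously and $\alpha(e)$ increases at unit rate for $e\in U$. Events are processed as they occur: (a) if $e\in U$, $i\in\mathrm{SOL}$, $\alpha(e)=d(e,i)$: remove $e$ from $U$ and set $\psi(e,L)=i$ for each $L$ with $\alpha(e)=d(e_L,i)$; (b) if $i\notin\mathrm{SOL}$ satisfies $\sum_{e\in U}\tau_e(\alpha(e)-d(e,i))^++\sum_{e\notin U}\tau_e\big(\alpha(e)-\min_{L\in[K]:\psi(e,L)=\bot}d(e_L,i)\big)^+=K\cdot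 f_i$ (a minimum over the empty set being $+\infty$): add $i$ to $\mathrm{SOL}$, set $\psi(e,L)=i$ for all $e\notin U$ and $L$ with $\psi(e,L)=\bot$ and $\alpha(e)\ge d(e_L,i)$, then for every $e\in U$ with $\alpha(e)\ge d(e,i)$ remove $e$ from $U$ and set $\psi(e,L)=i$ for each $L$ with $\alpha(e)\ge d(e_L,i)$. Stop when $U=\emptyset$; output $\mathrm{SOL}$. $\mathcal{P}^K(n)$: maximize $\sum_{a\in[n],b\in[a]}q(a,b)\alpha(a,b)$ over $f\ge0$ and $q(a,b),\alpha(a,b),\delta(a,b),\beta(a,b)\ge0$ ($a\in[n]$, $b\in[a]$) subject to (indices $a,a'\in[n]$, $b\in[a]$, $b'\in[a']$, $[x:y]=\{x,\dots,y\}$): (i) $\alpha(a,b)\le\alpha(a',b')$ whenever $b<b'$; (ii) $\alpha(a',b')\le\beta(a,b)+\delta(a,b)+\delta(a',b')$ whenever $a<a'$; (iii) for each $a\in[n-1]$: $\sum_{a'\in[a+1:n]}\sum_{b'\in[a]}q(a',b')(\alpha(a',b')-\delta(a',b'))^++\sum_{a'\in[a+1:n]}\sum_{b'\in[a+1:a']}q(a',b')(\alpha(a,a)-\delta(a',b'))^+\le K f$; (iv) $\delta(a,b)\le\alpha(a,b)$; (v) $\beta(a,b)\le\alpha(a,b)$; (vi) $f+\sum_{a,b}q(a,b)\delta(a,b)\le1$; (vii) $\sum_{a\in[b:n]}q(a,b)=1$ for each $b\in[n]$. $\mathrm{Obj}(\cdot)$ is the optimal (supremum) value. *)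

theory Defs
  imports "HOL-Analysis.Analysis"
begin

section \<open>The facility location problem with \<open>K\<close> locations per individual\<close>

text \<open>
  Locations are \<open>{1..n}\<close>, and a hyperedge is a \<open>K\<close>-tuple of locations, encoded as an
  extensional function on \<open>{1..K}\<close>.
\<close>

record lflp =
  nloc :: nat
  dst :: "nat \<Rightarrow> nat \<Rightarrow> real"
  fcost :: "nat \<Rightarrow> real"
  tau :: "(nat \<Rightarrow> nat) \<Rightarrow> real"

abbreviation locs :: "lflp \<Rightarrow> nat set" where
  "locs I \<equiv> {1..nloc I}"

definition hyperedges :: "nat \<Rightarrow> lflp \<Rightarrow> (nat \<Rightarrow> nat) set" where
  "hyperedges K I = {1..K} \<rightarrow>\<^sub>E locs I"

text \<open>
  \<^locale>\<open>Metric_space\<close> also asks for symmetry and nonnegativity of the distance outside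
  the carrier; this only concerns values that are never used.
\<close>

definition lflp_instance :: "nat \<Rightarrow> lflp \<Rightarrow> bool" where
  "lflp_instance K I \<longleftrightarrow>
     1 \<le> nloc I \<and>
     Metric_space (locs I) (dst I) \<and>
     (\<forall>i\<in>locs I. 0 \<le> fcost I i) \<and>
     (\<forall>e\<in>hyperedges K I. 0 \<le> tau I e)"

definition edist :: "nat \<Rightarrow> lflp \<Rightarrow> (nat \<Rightarrow> nat) \<Rightarrow> nat \<Rightarrow> real" where
  "edist K I e i = Min ((\<lambda>L. dst I (e L) i) ` {1..K})"

text \<open>The cost is meaningful for nonempty solutions only.\<close>

definition cost :: "nat \<Rightarrow> lflp \<Rightarrow> nat set \<Rightarrow> real" where
  "cost K I S =
     (\<Sum>i\<in>S. fcost I i) +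
     (\<Sum>e\<in>hyperedges K I. tau I e * Min ((\<lambda>i. edist K I e i) ` S))"

definition is_optimal :: "nat \<Rightarrow> lflp \<Rightarrow> nat set \<Rightarrow> bool" where
  "is_optimal K I = is_arg_min (cost K I) (\<lambda>S. S \<subseteq> locs I \<and> S \<noteq> {})"

text \<open>
  An algorithm is a relation between instances and possible outputs, so that the bound is
  required for every way of breaking ties.
\<close>

definition approx_ratio_at_most ::
    "nat \<Rightarrow> (lflp \<Rightarrow> nat set \<Rightarrow> bool) \<Rightarrow> ereal \<Rightarrow> bool" where
  "approx_ratio_at_most K alg \<Gamma> \<longleftrightarrow>
     (\<forall>I SOL OPT. lflp_instance K I \<longrightarrow> alg I SOL \<longrightarrow> is_optimal K I OPT \<longrightarrow>
        ereal (cost K I SOL) \<le> \<Gamma> * ereal (cost K I OPT))"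


section \<open>The Canonical \<open>K\<close>-Chance Greedy Algorithm\<close>

record gstate =
  sol :: "nat set"
  alpha :: "(nat \<Rightarrow> nat) \<Rightarrow> real"
  active :: "(nat \<Rightarrow> nat) set"
  psi :: "(nat \<Rightarrow> nat) \<Rightarrow> nat \<Rightarrow> nat option"

definition init_state :: "nat \<Rightarrow> lflp \<Rightarrow> gstate" where
  "init_state K I =
     \<lparr>sol = {}, alpha = (\<lambda>_. 0), active = hyperedges K I, psi = (\<lambda>_ _. None)\<rparr>"

text \<open>
  The bid of a hyperedge that has left \<^const>\<open>active\<close>; without remaining chances the
  minimum is \<open>+\<infinity>\<close> and the positive part is \<open>0\<close>.
\<close>

definition later_bid :: "nat \<Rightarrow> lflp \<Rightarrow> gstate \<Rightarrow> (nat \<Rightarrow> nat) \<Rightarrow> nat \<Rightarrow> real" where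
  "later_bid K I st e i =
     (let C = {L\<in>{1..K}. psi st e L = None} in
      if C = {} then 0
      else max (alpha st e - Min ((\<lambda>L. dst I (e L) i) ` C)) 0)"

definition total_bid :: "nat \<Rightarrow> lflp \<Rightarrow> gstate \<Rightarrow> nat \<Rightarrow> real" where
  "total_bid K I st i =
     (\<Sum>e\<in>active st. tau I e * max (alpha st e - edist K I e i) 0) +
     (\<Sum>e\<in>hyperedges K I - active st. tau I e * later_bid K I st e i)"

definition connect_event :: "nat \<Rightarrow> lflp \<Rightarrow> gstate \<Rightarrow> (nat \<Rightarrow> nat) \<Rightarrow> nat \<Rightarrow> bool" where
  "connect_event K I st e i \<longleftrightarrow>
     e \<in> active st \<and> i \<in> sol st \<and> alpha st e = edist K I e i"

definition open_event :: "nat \<Rightarrow> lflp \<Rightarrow> gstate \<Rightarrow> nat \<Rightarrow> bool" where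
  "open_event K I st i \<longleftrightarrow>
     i \<in> locs I - sol st \<and> total_bid K I st i = real K * fcost I i"

definition connect :: "nat \<Rightarrow> lflp \<Rightarrow> gstate \<Rightarrow> (nat \<Rightarrow> nat) \<Rightarrow> nat \<Rightarrow> gstate" where
  "connect K I st e i =
     st\<lparr>active := active st - {e},
        psi := (\<lambda>e' L.
          if e' = e \<and> L \<in> {1..K} \<and> alpha st e = dst I (e L) i
          then Some i else psi st e' L)\<rparr>"

definition open_facility :: "nat \<Rightarrow> lflp \<Rightarrow> gstate \<Rightarrow> nat \<Rightarrow> gstate" where
  "open_facility K I st i =
     st\<lparr>sol := insert i (sol st),
        active := {e\<in>active st. \<not> edist K I e i \<le> alpha st e},
        psi := (\<lambda>e L.
          if e \<in> hyperedges K I \<and> L \<in> {1..K} \<and> dst I (e L) i \<le> alpha st e \<and>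
             (e \<notin> active st \<and> psi st e L = None \<or>
              e \<in> active st \<and> edist K I e i \<le> alpha st e)
          then Some i else psi st e L)\<rparr>"

definition wait :: "real \<Rightarrow> gstate \<Rightarrow> gstate" where
  "wait s st =
     st\<lparr>alpha := (\<lambda>e. if e \<in> active st then alpha st e + s else alpha st e)\<rparr>"

text \<open>
  Continuous time: it may advance by \<open>s\<close> only if no event is pending now or occurs strictly
  before \<open>s\<close> more units of time have elapsed. Simultaneous events are processed one after
  the other in an arbitrary order, each being checked against the current state.
\<close>

inductive greedy_step :: "nat \<Rightarrow> lflp \<Rightarrow> gstate \<Rightarrow> gstate \<Rightarrow> bool" for K I where
  step_connect:
    "connect_event K I st e i \<Longrightarrow> greedy_step K I st (connect K I st e i)"
| step_open:
    "active st \<noteq> {} \<Longrightarrow> open_event K I st i \<Longrightarrow>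
     greedy_step K I st (open_facility K I st i)"
| step_wait:
    "active st \<noteq> {} \<Longrightarrow> 0 < s \<Longrightarrow>
     (\<And>r. 0 \<le> r \<Longrightarrow> r < s \<Longrightarrow>
        \<not> (\<exists>e i. connect_event K I (wait r st) e i) \<and>
        \<not> (\<exists>i. open_event K I (wait r st) i)) \<Longrightarrow>
     greedy_step K I st (wait s st)"

definition canonical_greedy :: "nat \<Rightarrow> lflp \<Rightarrow> nat set \<Rightarrow> bool" where
  "canonical_greedy K I SOL \<longleftrightarrow>
     (\<exists>st. (greedy_step K I)\<^sup>*\<^sup>* (init_state K I) st \<and> active st = {} \<and> sol st = SOL)"


section \<open>The strongly factor-revealing program\<close>

definition frp_feasible ::
    "nat \<Rightarrow> nat \<Rightarrow> real \<Rightarrow> (nat \<Rightarrow> nat \<Rightarrow> real) \<Rightarrow> (nat \<Rightarrow> nat \<Rightarrow> real) \<Rightarrow>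
     (nat \<Rightarrow> nat \<Rightarrow> real) \<Rightarrow> (nat \<Rightarrow> nat \<Rightarrow> real) \<Rightarrow> bool" where
  "frp_feasible K n f q \<alpha> \<delta> \<beta> \<longleftrightarrow>
     0 \<le> f \<and>
     (\<forall>a\<in>{1..n}. \<forall>b\<in>{1..a}. 0 \<le> q a b \<and> 0 \<le> \<alpha> a b \<and> 0 \<le> \<delta> a b \<and> 0 \<le> \<beta> a b) \<and>
     (\<forall>a\<in>{1..n}. \<forall>a'\<in>{1..n}. \<forall>b\<in>{1..a}. \<forall>b'\<in>{1..a'}.
        b < b' \<longrightarrow> \<alpha> a b \<le> \<alpha> a' b') \<and>
     (\<forall>a\<in>{1..n}. \<forall>a'\<in>{1..n}. \<forall>b\<in>{1..a}. \<forall>b'\<in>{1..a'}.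
        a < a' \<longrightarrow> \<alpha> a' b' \<le> \<beta> a b + \<delta> a b + \<delta> a' b') \<and>
     (\<forall>a\<in>{1..<n}.
        (\<Sum>a'\<in>{a+1..n}. \<Sum>b'\<in>{1..a}. q a' b' * max (\<alpha> a' b' - \<delta> a' b') 0) +
        (\<Sum>a'\<in>{a+1..n}. \<Sum>b'\<in>{a+1..a'}. q a' b' * max (\<alpha> a a - \<delta> a' b') 0)
        \<le> real K * f) \<and>
     (\<forall>a\<in>{1..n}. \<forall>b\<in>{1..a}. \<delta> a b \<le> \<alpha> a b) \<and>
     (\<forall>a\<in>{1..n}. \<forall>b\<in>{1..a}. \<beta> a b \<le> \<alpha> a b) \<and>
     f + (\<Sum>a\<in>{1..n}. \<Sum>b\<in>{1..a}. q a b * \<delta> a b) \<le> 1 \<and>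
     (\<forall>b\<in>{1..n}. (\<Sum>a\<in>{b..n}. q a b) = 1)"

text \<open>The supremum is taken in \<^typ>\<open>ereal\<close>: for \<open>n = 1\<close> the program is unbounded.\<close>

definition frp_Obj :: "nat \<Rightarrow> nat \<Rightarrow> ereal" where
  "frp_Obj K n =
     Sup {ereal (\<Sum>a\<in>{1..n}. \<Sum>b\<in>{1..a}. q a b * \<alpha> a b) | f q \<alpha> \<delta> \<beta>.
            frp_feasible K n f q \<alpha> \<delta> \<beta>}"

text \<open>
  The infimum ranges over positive \<open>n\<close>: for \<open>n = 0\<close> the objective is the empty sum.
\<close>

definition Gamma_SFR :: "nat \<Rightarrow> ereal" where
  "Gamma_SFR K = (INF n\<in>{1..}. frp_Obj K n)"

end

theory Submission
  imports Defs
begin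

text \<open>
  Dual fitting. Every hyperedge pays at most \<open>K\<close> times, so \<open>\<Sum>e. tau e * alpha e\<close> bounds the cost of
  the output, and it suffices to bound this sum on the hyperedges which a facility \<open>i\<close> of the
  optimal solution serves. Order them by the time at which their location closest to \<open>i\<close> is
  assigned: a later one satisfies \<open>\<alpha>' \<le> \<alpha> + \<delta> + \<delta>'\<close>, and at every time those still unassigned bid at
  most \<open>K * f\<close> for \<open>i\<close>. Cutting the mass, sorted by \<open>\<alpha>\<close>, into \<open>n\<close> chunks and averaging over the
  cells yields a point of the program.

  The program also constrains the cells which receive no mass. To fill them, the hyperedges of
  small \<open>\<alpha>\<close> are first replaced by lighter ones with proportionally larger \<open>\<alpha>\<close> and \<open>\<delta>\<close>, after which
  every \<open>\<alpha> - \<delta>\<close> is at most twice the smallest \<open>\<alpha>\<close>.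
\<close>



section \<open>From a star to the program\<close>

text \<open>
  One facility with its hyperedges: \<open>w\<close> are the weights, \<open>\<delta>\<close> the distances to the facility, \<open>\<theta>\<close> the
  assignment times, and \<open>B = K * f\<close>; bids are controlled from time \<open>y\<close> on only, because raising
  small values of \<open>\<alpha>\<close> destroys the bound at earlier times.
\<close>

definition star_data ::
    "'e set \<Rightarrow> ('e \<Rightarrow> real) \<Rightarrow> ('e \<Rightarrow> real) \<Rightarrow> ('e \<Rightarrow> real) \<Rightarrow> ('e \<Rightarrow> real) \<Rightarrow> real \<Rightarrow> real \<Rightarrow> bool"
  where
  "star_data S w \<alpha> \<delta> \<theta> y B \<longleftrightarrow>
     finite S \<and> S \<noteq> {} \<and>
     (\<forall>e\<in>S. 0 < w e \<and> 0 < \<alpha> e \<and> 0 \<le> \<delta> e \<and> \<delta> e \<le> \<alpha> e \<and> \<alpha> e \<le> \<theta> e) \<and>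
     (\<forall>e\<in>S. \<forall>e'\<in>S. \<theta> e < \<theta> e' \<longrightarrow> \<alpha> e' \<le> \<alpha> e + \<delta> e + \<delta> e') \<and>
     (\<forall>t\<ge>y. (\<Sum>e\<in>{e\<in>S. t \<le> \<theta> e}. w e * max (min (\<alpha> e) t - \<delta> e) 0) \<le> B)"

text \<open>A bid is a weight times a value, so its bound picks up both factors. Having two
  independent factors allows the total weight and the cost to be normalised at the same
  time.\<close>

lemma star_data_scale:
  assumes sd: "star_data S w \<alpha> \<delta> \<theta> y B" and "0 < \<rho>" "0 < \<sigma>"
  shows "star_data S (\<lambda>e. \<rho> * w e) (\<lambda>e. \<sigma> * \<alpha> e) (\<lambda>e. \<sigma> * \<delta> e) (\<lambda>e. \<sigma> * \<theta> e)
           (\<sigma> * y) (\<rho> * \<sigma> * B)"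
proof -
  have scale: "max (min (\<sigma> * a) (\<sigma> * t) - \<sigma> * d) 0 = \<sigma> * max (min a t - d) 0" for a t d
    using \<open>0 < \<sigma>\<close> by (simp add: min_mult_distrib_left max_mult_distrib_left algebra_simps)
  have budget: "(\<Sum>e\<in>{e\<in>S. t \<le> \<sigma> * \<theta> e}. \<rho> * w e * max (min (\<sigma> * \<alpha> e) t - \<sigma> * \<delta> e) 0) \<le> \<rho> * \<sigma> * B"
    if "\<sigma> * y \<le> t" for t
  proof -
    define u where "u = t / \<sigma>"
    have t: "t = \<sigma> * u" and "y \<le> u"
      using that \<open>0 < \<sigma>\<close> by (auto simp: u_def field_simps)
    have "(\<Sum>e\<in>{e\<in>S. t \<le> \<sigma> * \<theta> e}. \<rho> * w e * max (min (\<sigma> * \<alpha> e) t - \<sigma> * \<delta> e) 0)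
        = \<rho> * \<sigma> * (\<Sum>e\<in>{e\<in>S. u \<le> \<theta> e}. w e * max (min (\<alpha> e) u - \<delta> e) 0)"
      unfolding t scale sum_distrib_left using \<open>0 < \<sigma>\<close> by (intro sum.cong) auto
    also have "\<dots> \<le> \<rho> * \<sigma> * B"
      using sd \<open>y \<le> u\<close> \<open>0 < \<rho>\<close> \<open>0 < \<sigma>\<close> by (intro mult_left_mono) (auto simp: star_data_def)
    finally show ?thesis .
  qed
  have tri: "\<sigma> * \<alpha> e' \<le> \<sigma> * \<alpha> e + \<sigma> * \<delta> e + \<sigma> * \<delta> e'"
    if "e \<in> S" "e' \<in> S" "\<theta> e < \<theta> e'" for e e'
  proof -
    have "\<alpha> e' \<le> \<alpha> e + \<delta> e + \<delta> e'" using sd that by (auto simp: star_data_def)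
    then have "\<sigma> * \<alpha> e' \<le> \<sigma> * (\<alpha> e + \<delta> e + \<delta> e')" using \<open>0 < \<sigma>\<close> by simp
    then show ?thesis by (simp add: algebra_simps)
  qed
  show ?thesis
    using sd assms(2,3) tri budget unfolding star_data_def by auto
qed

text \<open>
  Multiplying the values of an edge by a factor and dividing its weight by the same factor
  changes neither its share of the objective and of the cost nor its final bid.
\<close>

lemma star_data_raise:
  assumes sd: "star_data S w \<alpha> \<delta> \<theta> 0 B"
  obtains w' \<alpha>' \<delta>' y where "star_data S w' \<alpha>' \<delta>' \<theta> y B"
    and "\<And>e. e \<in> S \<Longrightarrow> y \<le> \<alpha>' e" and "\<And>e. e \<in> S \<Longrightarrow> \<alpha>' e - \<delta>' e \<le> 2 * y"
    and "\<And>e. e \<in> S \<Longrightarrow> w' e * \<alpha>' e = w e * \<alpha> e"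
    and "\<And>e. e \<in> S \<Longrightarrow> w' e * \<delta>' e = w e * \<delta> e"
proof -
  have fin: "finite S" and pos: "\<And>e. e \<in> S \<Longrightarrow> 0 < w e \<and> 0 < \<alpha> e \<and> 0 \<le> \<delta> e \<and> \<delta> e \<le> \<alpha> e \<and> \<alpha> e \<le> \<theta> e"
    and tri: "\<And>e e'. e \<in> S \<Longrightarrow> e' \<in> S \<Longrightarrow> \<theta> e < \<theta> e' \<Longrightarrow> \<alpha> e' \<le> \<alpha> e + \<delta> e + \<delta> e'"
    and budget: "\<And>t. 0 \<le> t \<Longrightarrow> (\<Sum>e\<in>{e\<in>S. t \<le> \<theta> e}. w e * max (min (\<alpha> e) t - \<delta> e) 0) \<le> B"
    using sd by (auto simp: star_data_def)
  have "S \<noteq> {}" using sd by (auto simp: star_data_def)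
  \<comment> \<open>\<open>good t\<close> bounds the gap \<open>\<alpha> - \<delta>\<close> of the
    edges assigned after \<open>t\<close>. An edge assigned by time \<open>t\<close> has gap at most
    \<open>\<theta> \<le> t\<close> anyway, so the least good candidate \<open>y\<close> is a valid
    threshold for all edges.\<close>
  define good where "good t \<longleftrightarrow> (\<forall>e\<in>S. t < \<theta> e \<longrightarrow> \<alpha> e - \<delta> e \<le> 2 * t)" for t
  define C where "C = \<theta> ` S \<union> (\<lambda>e. (\<alpha> e - \<delta> e) / 2) ` S"
  have finC: "finite C" using fin by (simp add: C_def)
  have C0: "0 \<le> c" if "c \<in> C" for c using that pos by (force simp: C_def)
  \<comment> \<open>Half the largest gap is good, so a least good candidate exists.\<close>
  define M where "M = Max ((\<lambda>e. (\<alpha> e - \<delta> e) / 2) ` S)"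
  have "M \<in> (\<lambda>e. (\<alpha> e - \<delta> e) / 2) ` S" unfolding M_def using fin \<open>S \<noteq> {}\<close> by (intro Max_in) auto
  then have "M \<in> C" by (auto simp: C_def)
  have "(\<alpha> e - \<delta> e) / 2 \<le> M" if "e \<in> S" for e
    unfolding M_def using fin that by (intro Max_ge) auto
  then have "good M" unfolding good_def by fastforce
  define y where "y = Min {c\<in>C. good c}"
  have "y \<in> {c\<in>C. good c}" unfolding y_def
    using finC \<open>M \<in> C\<close> \<open>good M\<close> by (intro Min_in) auto
  then have y: "good y" "0 \<le> y" using C0 by auto
  have least: "y \<le> c" if "c \<in> C" "good c" for c
    unfolding y_def using finC that by (intro Min_le) auto
  \<comment> \<open>Otherwise \<open>\<theta> e < y\<close> would be good by the triangle condition, as \<open>\<delta> e \<le> \<alpha> e \<le> \<theta> e\<close>.\<close>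
  have late: "y \<le> \<theta> e" if "e \<in> S" "\<alpha> e < y" for e
  proof (rule ccontr)
    assume "\<not> y \<le> \<theta> e"
    then have "\<not> good (\<theta> e)" using least[of "\<theta> e"] that by (auto simp: C_def)
    then obtain e' where "e' \<in> S" "\<theta> e < \<theta> e'" "2 * \<theta> e < \<alpha> e' - \<delta> e'"
      by (auto simp: good_def)
    then show False using tri[of e e'] pos[of e] that by auto
  qed
  \<comment> \<open>The factor lifts \<open>\<alpha>\<close> exactly to \<open>y\<close> where it is
    smaller and is 1 elsewhere. By \<open>late\<close> a lifted value still does not exceed
    \<open>\<theta>\<close>.\<close>
  define s where "s e = max 1 (y / \<alpha> e)" for e
  have s1: "1 \<le> s e" for e by (simp add: s_def)
  have spos: "0 < s e" for e using s1[of e] by linarith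
  have low: "s e * \<alpha> e = y" if "e \<in> S" "\<alpha> e < y" for e
    using that pos[of e] by (auto simp: s_def max_def field_simps)
  have high: "s e = 1" if "e \<in> S" "y \<le> \<alpha> e" for e
    using that pos[of e] by (auto simp: s_def max_def field_simps)
  have a_ge: "\<alpha> e \<le> s e * \<alpha> e" if "e \<in> S" for e
    using pos[OF that] s1[of e] mult_right_mono[of 1 "s e" "\<alpha> e"] by simp
  have d_ge: "\<delta> e \<le> s e * \<delta> e" if "e \<in> S" for e
    using pos[OF that] s1[of e] mult_right_mono[of 1 "s e" "\<delta> e"] by simp
  have sd_le: "s e * \<delta> e \<le> s e * \<alpha> e" if "e \<in> S" for e
    using pos[OF that] spos[of e] by simp
  have sd0: "0 \<le> s e * \<delta> e" if "e \<in> S" for e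
    using pos[OF that] spos[of e] by simp
  have sa_y: "y \<le> s e * \<alpha> e" if "e \<in> S" for e
    using low[OF that] high[OF that] by (cases "\<alpha> e < y") auto
  have sa_th: "s e * \<alpha> e \<le> \<theta> e" if "e \<in> S" for e
    using low[OF that] high[OF that] late[OF that] pos[OF that] by (cases "\<alpha> e < y") auto
  have gap: "s e * \<alpha> e - s e * \<delta> e \<le> 2 * y" if "e \<in> S" for e
  proof (cases "\<alpha> e < y")
    case True
    then show ?thesis using low[OF that] sd0[OF that] y by simp
  next
    case False
    then have "s e = 1" using high[OF that] by simp
    moreover have "\<alpha> e - \<delta> e \<le> 2 * y"
    proof (cases "y < \<theta> e")
      case True
      then show ?thesis using y that by (auto simp: good_def)
    qed (use pos[OF that] y in auto)
    ultimately show ?thesis by simp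
  qed
  \<comment> \<open>A raised \<open>e'\<close> has value \<open>y\<close>, which is at most the
    value of \<open>e\<close>. For an unraised \<open>e'\<close> only the terms of \<open>e\<close>
    can change, and they grow.\<close>
  have tri': "s e' * \<alpha> e' \<le> s e * \<alpha> e + s e * \<delta> e + s e' * \<delta> e'"
    if "e \<in> S" "e' \<in> S" "\<theta> e < \<theta> e'" for e e'
  proof (cases "\<alpha> e' < y")
    case True
    then show ?thesis using low[OF that(2)] sa_y[OF that(1)] sd0[OF that(1)] sd0[OF that(2)] by simp
  next
    case False
    then show ?thesis
      using high[OF that(2)] tri[OF that] a_ge[OF that(1)] d_ge[OF that(1)] by simp
  qed
  \<comment> \<open>From time \<open>y\<close> on, the cut at \<open>t\<close> touches no raised
    edge, neither before nor after raising. Its bid is then weight times gap, which the factor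
    cancels out of.\<close>
  have budget': "(\<Sum>e\<in>{e\<in>S. t \<le> \<theta> e}. w e / s e * max (min (s e * \<alpha> e) t - s e * \<delta> e) 0) \<le> B"
    if "y \<le> t" for t
  proof -
    have "w e / s e * max (min (s e * \<alpha> e) t - s e * \<delta> e) 0 = w e * max (min (\<alpha> e) t - \<delta> e) 0"
      if "e \<in> S" for e
    proof (cases "\<alpha> e < y")
      case True
      then have "min (s e * \<alpha> e) t = s e * \<alpha> e" "min (\<alpha> e) t = \<alpha> e"
        using low[OF that] \<open>y \<le> t\<close> by auto
      moreover have "max (s e * \<alpha> e - s e * \<delta> e) 0 = s e * (\<alpha> e - \<delta> e)"
        using sd_le[OF that] by (simp add: algebra_simps)
      ultimately show ?thesis using spos[of e] pos[OF that] by simp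
    next
      case False
      then show ?thesis using high[OF that] by simp
    qed
    then have "(\<Sum>e\<in>{e\<in>S. t \<le> \<theta> e}. w e / s e * max (min (s e * \<alpha> e) t - s e * \<delta> e) 0)
             = (\<Sum>e\<in>{e\<in>S. t \<le> \<theta> e}. w e * max (min (\<alpha> e) t - \<delta> e) 0)"
      by (intro sum.cong) auto
    then show ?thesis using budget[of t] that y by simp
  qed
  have "star_data S (\<lambda>e. w e / s e) (\<lambda>e. s e * \<alpha> e) (\<lambda>e. s e * \<delta> e) \<theta> y B"
    unfolding star_data_def
    using fin \<open>S \<noteq> {}\<close> pos spos sd0 sd_le sa_th tri' budget' by auto
  then show thesis
    by (rule that) (use sa_y gap spos in \<open>auto simp: less_imp_neq[THEN not_sym]\<close>)
qed

text \<open>Lay the edges end to end on \<open>[0, n]\<close>, as intervals of length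
  \<open>w\<close> in increasing order of \<open>\<alpha>\<close>; \<open>m e b\<close> is the
  length of the part of \<open>e\<close> inside \<open>[b - 1, b]\<close>.\<close>

lemma ex_sorted_chunks:
  fixes w \<alpha> :: "'e \<Rightarrow> real"
  assumes "finite S" and "\<And>e. e \<in> S \<Longrightarrow> 0 < w e" and "sum w S = real n"
  shows "\<exists>m :: 'e \<Rightarrow> nat \<Rightarrow> real.
    (\<forall>e\<in>S. \<forall>b\<ge>1. 0 \<le> m e b) \<and>
    (\<forall>e\<in>S. (\<Sum>b\<in>{1..n}. m e b) = w e) \<and>
    (\<forall>b\<in>{1..n}. (\<Sum>e\<in>S. m e b) = 1) \<and>
    (\<forall>e\<in>S. \<forall>e'\<in>S. \<forall>b\<ge>1. \<forall>b'>b. 0 < m e b \<longrightarrow> 0 < m e' b' \<longrightarrow> \<alpha> e \<le> \<alpha> e')"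
proof -
  \<comment> \<open>For \<open>0 \<le> x\<close>, the length of the part of
    \<open>[b - 1, b]\<close> below \<open>x\<close>. Chunks start at \<open>b = 1\<close>: for
    \<open>b = 0\<close> the formula describes a chunk that is already full at
    \<open>x = 0\<close>.\<close>
  define c :: "nat \<Rightarrow> real \<Rightarrow> real" where "c b x = min (max (x - (real b - 1)) 0) 1" for b x
  have c_mono: "c b x \<le> c b x'" if "x \<le> x'" for b x x'
    using that by (auto simp: c_def)
  have c_sum: "(\<Sum>b\<in>{1..k}. c b x) = min x (real k)" if "0 \<le> x" for x k
    using that by (induction k) (auto simp: c_def)
  \<comment> \<open>The induction runs through prefixes of the order, so chunks may be partly
    filled. The pieces add up to \<open>w\<close> only while the total stays within
    \<open>n\<close>, since further mass lies beyond chunk \<open>n\<close>.\<close>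
  have ex: "\<exists>m. (\<forall>e\<in>S. \<forall>b\<ge>1. 0 \<le> m e b) \<and>
          (sum w S \<le> real n \<longrightarrow> (\<forall>e\<in>S. (\<Sum>b\<in>{1..n}. m e b) = w e)) \<and>
          (\<forall>b\<ge>1. (\<Sum>e\<in>S. m e b) = c b (sum w S)) \<and>
          (\<forall>e\<in>S. \<forall>e'\<in>S. \<forall>b\<ge>1. \<forall>b'>b. 0 < m e b \<longrightarrow> 0 < m e' b' \<longrightarrow> \<alpha> e \<le> \<alpha> e')"
    using assms(1,2)
  proof (induction S rule: finite_ranking_induct[where f = \<alpha>])
    case empty
    then show ?case by (auto simp: c_def)
  next
    case (insert x S)
    show ?case
    proof (cases "x \<in> S")
      case True
      then show ?thesis using insert by (simp add: insert_absorb)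
    next
      case False
      define W where "W = sum w S"
      have "0 \<le> W" unfolding W_def using insert.prems by (intro sum_nonneg) (auto intro: less_imp_le)
      have wx: "0 < w x" using insert.prems by auto
      obtain m where m: "\<And>e b. e \<in> S \<Longrightarrow> 1 \<le> b \<Longrightarrow> 0 \<le> m e b"
        "\<And>e. W \<le> real n \<Longrightarrow> e \<in> S \<Longrightarrow> (\<Sum>b\<in>{1..n}. m e b) = w e"
        "\<And>b. 1 \<le> b \<Longrightarrow> (\<Sum>e\<in>S. m e b) = c b W"
        "\<And>e e' b b'. e \<in> S \<Longrightarrow> e' \<in> S \<Longrightarrow> 1 \<le> b \<Longrightarrow> b < b' \<Longrightarrow> 0 < m e b \<Longrightarrow> 0 < m e' b' \<Longrightarrow> \<alpha> e \<le> \<alpha> e'"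
      proof -
        have "0 < w e" if "e \<in> S" for e using insert.prems that by simp
        from insert.IH[OF this] obtain m where
          "\<forall>e\<in>S. \<forall>b\<ge>1. 0 \<le> m e b"
          "W \<le> real n \<longrightarrow> (\<forall>e\<in>S. (\<Sum>b\<in>{1..n}. m e b) = w e)"
          "\<forall>b\<ge>1. (\<Sum>e\<in>S. m e b) = c b W"
          "\<forall>e\<in>S. \<forall>e'\<in>S. \<forall>b\<ge>1. \<forall>b'>b. 0 < m e b \<longrightarrow> 0 < m e' b' \<longrightarrow> \<alpha> e \<le> \<alpha> e'"
          unfolding W_def by blast
        then show thesis by (intro that[of m]) blast+
      qed
      \<comment> \<open>\<open>x\<close> has the largest \<open>\<alpha>\<close> so far and takes
        the stretch from \<open>W\<close> to \<open>W + w x\<close>.\<close>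
      define m' where "m' = m(x := \<lambda>b. c b (W + w x) - c b W)"
      have m'x: "m' x b = c b (W + w x) - c b W" for b by (simp add: m'_def)
      have m'S: "m' e = m e" if "e \<in> S" for e using that False by (auto simp: m'_def)
      have sumw: "sum w (insert x S) = W + w x" using False insert.hyps by (simp add: W_def)
      have s4: "\<alpha> e \<le> \<alpha> e'"
        if "e \<in> insert x S" "e' \<in> insert x S" "1 \<le> b" "b < b'" "0 < m' e b" "0 < m' e' b'" for e e' b b'
      proof (cases "e' = x")
        case True
        then show ?thesis using that insert.hyps by auto
      next
        case False
        then have e': "e' \<in> S" using that by auto
        show ?thesis
        proof (cases "e = x")
          case True
          \<comment> \<open>Mass of \<open>x\<close> in chunk \<open>b\<close> forces
            \<open>W < b\<close>; mass of an older edge in chunk \<open>b'\<close> forces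
            \<open>b' - 1 < W\<close>. This contradicts \<open>b < b'\<close>.\<close>
          have "c b W < 1" using that(5) True m'x[of b] by (auto simp: c_def)
          then have "W < real b" by (auto simp: c_def min_def max_def split: if_splits)
          have "m e' b' \<le> (\<Sum>e\<in>S. m e b')"
            using e' insert.hyps m(1) that by (intro member_le_sum) auto
          then have "0 < c b' W" using that m(3)[of b'] m'S[OF e'] by auto
          then have "real b' - 1 < W" by (auto simp: c_def min_def max_def split: if_splits)
          then show ?thesis using \<open>W < real b\<close> \<open>b < b'\<close> by simp
        next
          case False
          then show ?thesis using that e' m(4)[of e e' b b'] m'S by auto
        qed
      qed
      have s1: "0 \<le> m' e b" if "e \<in> insert x S" "1 \<le> b" for e b
        using that m(1) m'S m'x c_mono[of W "W + w x" b] wx by (cases "e = x") auto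
      have s2: "(\<Sum>b\<in>{1..n}. m' e b) = w e" if "e \<in> insert x S" "W + w x \<le> real n" for e
        using that m(2) m'S m'x wx \<open>0 \<le> W\<close> by (cases "e = x") (auto simp: sum_subtractf c_sum[simplified])
      have s3: "(\<Sum>e\<in>insert x S. m' e b) = c b (W + w x)" if "1 \<le> b" for b
      proof -
        have "(\<Sum>e\<in>S. m' e b) = c b W" using m(3)[OF that] m'S by (simp cong: sum.cong)
        then show ?thesis using False insert.hyps m'x by simp
      qed
      show ?thesis unfolding sumw
        using s1 s2 s3 s4 by (intro exI[of _ m'] conjI) blast+
    qed
  qed
  obtain m where m: "\<forall>e\<in>S. \<forall>b\<ge>1. 0 \<le> m e b" "\<forall>e\<in>S. (\<Sum>b\<in>{1..n}. m e b) = w e"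
    "\<forall>b\<ge>1. (\<Sum>e\<in>S. m e b) = c b (real n)"
    "\<forall>e\<in>S. \<forall>e'\<in>S. \<forall>b\<ge>1. \<forall>b'>b. 0 < m e b \<longrightarrow> 0 < m e' b' \<longrightarrow> \<alpha> e \<le> \<alpha> e'"
    using ex unfolding assms(3) by blast
  have "c b (real n) = 1" if "b \<in> {1..n}" for b
    using that by (auto simp: c_def)
  then show ?thesis
    using m by (intro exI[of _ m] conjI) auto
qed

text \<open>The mass of an edge is split over the chunks \<open>b\<close>, but all of it lies in one
  row \<open>a\<close>, determined by the assignment time. Each cell carries the mass and the
  weighted averages of its pieces: linear constraints survive averaging, and the bid constraint does
  because the positive part is convex.\<close>

lemma frp_Obj_ge_star:
  assumes sd: "star_data S w \<alpha> \<delta> \<theta> y (real K * f)"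
    and y: "\<And>e. e \<in> S \<Longrightarrow> y \<le> \<alpha> e" "\<And>e. e \<in> S \<Longrightarrow> \<alpha> e - \<delta> e \<le> 2 * y"
    and total: "sum w S = real n" and "0 \<le> f" and budget: "f + (\<Sum>e\<in>S. w e * \<delta> e) \<le> 1"
  shows "ereal (\<Sum>e\<in>S. w e * \<alpha> e) \<le> frp_Obj K n"
proof -
  have fin: "finite S"
    and pos: "\<And>e. e \<in> S \<Longrightarrow> 0 < w e \<and> 0 < \<alpha> e \<and> 0 \<le> \<delta> e \<and> \<delta> e \<le> \<alpha> e \<and> \<alpha> e \<le> \<theta> e"
    and tri: "\<And>e e'. e \<in> S \<Longrightarrow> e' \<in> S \<Longrightarrow> \<theta> e < \<theta> e' \<Longrightarrow> \<alpha> e' \<le> \<alpha> e + \<delta> e + \<delta> e'"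
    and bids: "\<And>t. y \<le> t \<Longrightarrow>
      (\<Sum>e\<in>{e\<in>S. t \<le> \<theta> e}. w e * max (min (\<alpha> e) t - \<delta> e) 0) \<le> real K * f"
    using sd by (auto simp: star_data_def)
  have "\<And>e. e \<in> S \<Longrightarrow> 0 < w e" using pos by blast
  from ex_sorted_chunks[OF fin this total, of \<alpha>] obtain m :: "_ \<Rightarrow> nat \<Rightarrow> real" where
    m: "\<forall>e\<in>S. \<forall>b\<ge>1. 0 \<le> m e b" "\<forall>e\<in>S. (\<Sum>b\<in>{1..n}. m e b) = w e"
      "\<forall>b\<in>{1..n}. (\<Sum>e\<in>S. m e b) = 1"
      "\<forall>e\<in>S. \<forall>e'\<in>S. \<forall>b\<ge>1. \<forall>b'>b. 0 < m e b \<longrightarrow> 0 < m e' b' \<longrightarrow> \<alpha> e \<le> \<alpha> e'"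
    by blast
  have m0: "0 \<le> m e b" if "e \<in> S" "1 \<le> b" for e b using m(1) that by blast
  have m_w: "(\<Sum>b\<in>{1..n}. m e b) = w e" if "e \<in> S" for e using m(2) that by blast
  have m_1: "(\<Sum>e\<in>S. m e b) = 1" if "b \<in> {1..n}" for b using m(3) that by blast
  have m_sorted: "\<alpha> e \<le> \<alpha> e'"
    if "e \<in> S" "e' \<in> S" "1 \<le> b" "b < b'" "0 < m e b" "0 < m e' b'" for e e' b b'
    using m(4) that by blast
  \<comment> \<open>The time at which chunk \<open>b\<close> begins.\<close>
  define lo where "lo b = Min (\<alpha> ` {e\<in>S. 0 < m e b})" for b
  have chunk_ne: "\<exists>e\<in>S. 0 < m e b" if "b \<in> {1..n}" for b
  proof (rule ccontr)
    assume "\<not> ?thesis"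
    then have "(\<Sum>e\<in>S. m e b) \<le> 0" by (intro sum_nonpos) (auto simp: not_less)
    then show False using m_1[OF that] by simp
  qed
  have lo_le: "lo b \<le> \<alpha> e" if "e \<in> S" "0 < m e b" for e b
    unfolding lo_def using fin that by (intro Min_le) auto
  have lo_ge: "x \<le> lo b" if "b \<in> {1..n}" "\<And>e. e \<in> S \<Longrightarrow> 0 < m e b \<Longrightarrow> x \<le> \<alpha> e" for x b
    unfolding lo_def using fin that chunk_ne[OF that(1)] by (subst Min_ge_iff) auto
  have le_lo: "\<alpha> e \<le> lo b'" if "e \<in> S" "0 < m e b" "1 \<le> b" "b < b'" "b' \<le> n" for e b b'
    using that m_sorted[of e _ b b'] by (intro lo_ge) auto
  have lo_mono: "lo b \<le> lo b'" if "1 \<le> b" "b \<le> b'" "b' \<le> n" for b b'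
  proof (cases "b = b'")
    case False
    have "b \<in> {1..n}" using that by auto
    then obtain e where "e \<in> S" "0 < m e b" using chunk_ne by blast
    then show ?thesis using le_lo[of e b b'] lo_le[of e b] that False by linarith
  qed simp
  have y_lo: "y \<le> lo b" if "b \<in> {1..n}" for b
    using that y(1) by (intro lo_ge) auto
  have lo_0: "0 \<le> lo b" if "b \<in> {1..n}" for b
    using that pos by (intro lo_ge) (auto intro: less_imp_le)
  have has_mass: "\<exists>b\<in>{1..n}. 0 < m e b" if "e \<in> S" for e
  proof (rule ccontr)
    assume "\<not> ?thesis"
    then have "(\<Sum>b\<in>{1..n}. m e b) \<le> 0" by (intro sum_nonpos) (auto simp: not_less)
    then show False using m_w[OF that] pos[OF that] by simp
  qed

  \<comment> \<open>The row of \<open>e\<close> is the last chunk begun by time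
    \<open>\<theta> e\<close>. Since \<open>\<alpha> \<le> \<theta>\<close>, mass in chunk
    \<open>b\<close> lies in a row \<open>a \<ge> b\<close>, so all mass falls on the triangular
    index set of the program.\<close>
  define A where "A e = Max {a\<in>{1..n}. lo a \<le> \<theta> e}" for e
  have le_A: "a \<le> A e" if "a \<in> {1..n}" "lo a \<le> \<theta> e" for a e
    unfolding A_def using that by (intro Max_ge) auto
  have mass_A: "b \<le> A e" if "e \<in> S" "b \<in> {1..n}" "0 < m e b" for e b
    using that lo_le[of e b] pos[of e] by (intro le_A) auto
  have A_in: "A e \<in> {a\<in>{1..n}. lo a \<le> \<theta> e}" if e: "e \<in> S" for e
  proof -
    obtain b where "b \<in> {1..n}" "0 < m e b" using has_mass[OF e] by blast
    then have "b \<in> {a\<in>{1..n}. lo a \<le> \<theta> e}"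
      using e lo_le[of e b] pos[of e] by auto
    then show ?thesis unfolding A_def by (intro Max_in) auto
  qed
  have A_range: "A e \<in> {1..n}" and lo_A: "lo (A e) \<le> \<theta> e" if "e \<in> S" for e
    using A_in[OF that] by auto
  have m_beyond: "m e b = 0" if "e \<in> S" "b \<in> {1..n}" "A e < b" for e b
    using mass_A[OF that(1,2)] m0[of e b] that by fastforce

  \<comment> \<open>A cell without mass gets \<open>\<alpha> = \<delta> = \<beta> = lo b\<close>; the triangle constraint out of it then reads
    \<open>\<alpha>' - \<delta>' \<le> 2 * lo b\<close>.\<close>
  define cell where "cell a = {e\<in>S. A e = a}" for a
  define q where "q a b = (\<Sum>e\<in>cell a. m e b)" for a b
  define av where "av g a b = (if q a b = 0 then lo b else (\<Sum>e\<in>cell a. m e b * g e) / q a b)"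
    for g a b
  have finc: "finite (cell a)" for a using fin by (simp add: cell_def)
  have cellS: "e \<in> S" "A e = a" if "e \<in> cell a" for e a using that by (auto simp: cell_def)
  have m0c: "0 \<le> m e b" if "e \<in> cell a" "1 \<le> b" for e a b
    using m0 cellS that by blast
  have q0: "0 \<le> q a b" if "1 \<le> b" for a b
    unfolding q_def using m0c that by (intro sum_nonneg) auto
  have q_zero: "m e b = 0" if "q a b = 0" "e \<in> cell a" "1 \<le> b" for a b e
    using that sum_nonneg_eq_0_iff[OF finc[of a], of "\<lambda>e. m e b"] m0c[of _ a b] by (auto simp: q_def)
  have qav: "q a b * av g a b = (\<Sum>e\<in>cell a. m e b * g e)" if "1 \<le> b" for a b g
  proof (cases "q a b = 0")
    case True
    then have "(\<Sum>e\<in>cell a. m e b * g e) = 0" using q_zero that by (intro sum.neutral) auto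
    then show ?thesis using True by simp
  qed (simp add: av_def)
  have av_le: "av g a b \<le> u"
    if "1 \<le> b" "q a b \<noteq> 0" "\<And>e. e \<in> cell a \<Longrightarrow> 0 < m e b \<Longrightarrow> g e \<le> u" for g a b u
  proof -
    have "m e b * g e \<le> m e b * u" if "e \<in> cell a" for e
      using that(1) \<open>1 \<le> b\<close> m0c[of e a b] that(1) \<open>\<And>e. e \<in> cell a \<Longrightarrow> 0 < m e b \<Longrightarrow> g e \<le> u\<close>
      by (cases "m e b = 0") (auto intro!: mult_left_mono)
    then have "q a b * av g a b \<le> q a b * u"
      unfolding qav[OF that(1)] by (simp add: q_def sum_distrib_right sum_mono)
    then show ?thesis using q0[of b a] that by simp
  qed
  have av_ge: "l \<le> av g a b"
    if "1 \<le> b" "q a b \<noteq> 0" "\<And>e. e \<in> cell a \<Longrightarrow> 0 < m e b \<Longrightarrow> l \<le> g e" for g a b l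
  proof -
    have "m e b * l \<le> m e b * g e" if "e \<in> cell a" for e
      using that(1) \<open>1 \<le> b\<close> m0c[of e a b] that(1) \<open>\<And>e. e \<in> cell a \<Longrightarrow> 0 < m e b \<Longrightarrow> l \<le> g e\<close>
      by (cases "m e b = 0") (auto intro!: mult_left_mono)
    then have "q a b * l \<le> q a b * av g a b"
      unfolding qav[OF that(1)] by (simp add: q_def sum_distrib_right sum_mono)
    then show ?thesis using q0[of b a] that by simp
  qed
  have av_add: "av (\<lambda>e. g e + h e) a b = av g a b + av h a b" if "q a b \<noteq> 0" for g h a b
    using that by (simp add: av_def algebra_simps sum.distrib add_divide_distrib)
  have av_diff: "av (\<lambda>e. g e - h e) a b = av g a b - av h a b" if "q a b \<noteq> 0" for g h a b
    using that by (simp add: av_def algebra_simps sum_subtractf diff_divide_distrib)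

  have sum_cells: "(\<Sum>a\<in>{1..n}. \<Sum>e\<in>cell a. g e) = sum g S" for g :: "_ \<Rightarrow> real"
    unfolding cell_def using fin A_range by (intro sum.group) auto
  \<comment> \<open>With \<open>\<delta>\<close> and \<open>\<alpha>\<close> for \<open>g\<close>,
    this transfers the cost and the objective. Columns beyond \<open>a\<close> may be added to row
    \<open>a\<close> because they carry no mass there.\<close>
  have sum_all: "(\<Sum>a\<in>{1..n}. \<Sum>b\<in>{1..a}. q a b * av g a b) = (\<Sum>e\<in>S. w e * g e)" for g
  proof -
    have "(\<Sum>b\<in>{1..a}. q a b * av g a b) = (\<Sum>e\<in>cell a. w e * g e)" if "a \<in> {1..n}" for a
    proof -
      have "(\<Sum>b\<in>{1..a}. q a b * av g a b) = (\<Sum>b\<in>{1..a}. \<Sum>e\<in>cell a. m e b * g e)"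
        by (intro sum.cong) (auto simp: qav)
      also have "\<dots> = (\<Sum>b\<in>{1..n}. \<Sum>e\<in>cell a. m e b * g e)"
        using that m_beyond cellS by (intro sum.mono_neutral_left) (auto intro!: sum.neutral)
      also have "\<dots> = (\<Sum>e\<in>cell a. \<Sum>b\<in>{1..n}. m e b * g e)"
        by (rule sum.swap)
      also have "\<dots> = (\<Sum>e\<in>cell a. w e * g e)"
        using m_w cellS by (intro sum.cong) (auto simp flip: sum_distrib_right)
      finally show ?thesis .
    qed
    then show ?thesis using sum_cells[of "\<lambda>e. w e * g e"] by simp
  qed

  \<comment> \<open>Order, triangle and bid constraints for the averages\<close>
  have av_\<alpha>_ge: "lo b \<le> av \<alpha> a b" if "b \<in> {1..n}" for a b
  proof (cases "q a b = 0")
    case False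
    then show ?thesis using that lo_le cellS by (intro av_ge) auto
  qed (simp add: av_def)
  have av_\<alpha>_le: "av \<alpha> a b \<le> lo b'" if "b \<in> {1..n}" "b' \<in> {1..n}" "b < b'" for a b b'
  proof (cases "q a b = 0")
    case True
    then show ?thesis using lo_mono[of b b'] that by (simp add: av_def)
  next
    case False
    then show ?thesis using that le_lo cellS by (intro av_le) auto
  qed
  have av_\<delta>_0: "0 \<le> av \<delta> a b" if "b \<in> {1..n}" for a b
  proof (cases "q a b = 0")
    case True
    then show ?thesis using lo_0 that by (simp add: av_def)
  next
    case False
    then show ?thesis using that pos cellS by (intro av_ge) auto
  qed
  have av_\<delta>_\<alpha>: "av \<delta> a b \<le> av \<alpha> a b" if "b \<in> {1..n}" for a b
  proof (cases "q a b = 0")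
    case True
    then show ?thesis by (simp add: av_def)
  next
    case False
    have "0 \<le> av (\<lambda>e. \<alpha> e - \<delta> e) a b" using that False pos cellS by (intro av_ge) auto
    then show ?thesis using av_diff[OF False] by simp
  qed
  have c_tri: "av \<alpha> a' b' \<le> av \<alpha> a b + av \<delta> a b + av \<delta> a' b'"
    if "a < a'" "a' \<in> {1..n}" "b \<in> {1..n}" "b' \<in> {1..n}" for a a' b b'
  proof (cases "q a' b' = 0")
    case True
    then have "av \<alpha> a' b' = av \<delta> a' b'" by (simp add: av_def)
    then show ?thesis using av_\<delta>_0[OF that(3)] av_\<delta>_\<alpha>[OF that(3)] by (smt (verit))
  next
    case False
    have "\<alpha> e' - \<delta> e' \<le> av \<alpha> a b + av \<delta> a b" if e': "e' \<in> cell a'" for e'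
    proof (cases "q a b = 0")
      case True
      then show ?thesis
        using y(2)[OF cellS(1)[OF e']] y_lo[OF \<open>b \<in> {1..n}\<close>] by (simp add: av_def)
    next
      case False
      have "\<alpha> e' - \<delta> e' \<le> \<alpha> e + \<delta> e" if e: "e \<in> cell a" for e
      proof -
        \<comment> \<open>Being in row \<open>a < a'\<close> means that chunk \<open>a'\<close> has
          not begun by \<open>\<theta> e\<close>, whereas it has begun by
          \<open>\<theta> e'\<close>; hence \<open>\<theta> e < \<theta> e'\<close>.\<close>
        have "\<theta> e < lo a'"
          using le_A[of a' e] \<open>a' \<in> {1..n}\<close> \<open>a < a'\<close> cellS(2)[OF e] by fastforce
        then show ?thesis
          using tri[of e e'] lo_A[of e'] cellS[OF e] cellS[OF e'] by fastforce
      qed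
      then have "\<alpha> e' - \<delta> e' \<le> av (\<lambda>e. \<alpha> e + \<delta> e) a b"
        using False \<open>b \<in> {1..n}\<close> by (intro av_ge) auto
      then show ?thesis using av_add[OF False] by simp
    qed
    then have "av (\<lambda>e. \<alpha> e - \<delta> e) a' b' \<le> av \<alpha> a b + av \<delta> a b"
      using False \<open>b' \<in> {1..n}\<close> by (intro av_le) auto
    then show ?thesis using av_diff[OF False] by simp
  qed

  have c_bids: "(\<Sum>a'\<in>{a+1..n}. \<Sum>b'\<in>{1..a}. q a' b' * max (av \<alpha> a' b' - av \<delta> a' b') 0) +
      (\<Sum>a'\<in>{a+1..n}. \<Sum>b'\<in>{a+1..a'}. q a' b' * max (av \<alpha> a a - av \<delta> a' b') 0) \<le> real K * f"
    if a: "a \<in> {1..<n}" for a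
  proof -
    \<comment> \<open>The budget is used at the start of chunk \<open>a + 1\<close>. Pieces in
      chunks up to \<open>a\<close> have \<open>\<alpha> \<le> t\<close>, those in later chunks have
      \<open>t \<le> \<alpha>\<close>, and \<open>av \<alpha> a a \<le> t\<close>; so the bids
      \<open>h\<close> at time \<open>t\<close> dominate both sums.\<close>
    define t where "t = lo (a + 1)"
    define h where "h e = max (min (\<alpha> e) t - \<delta> e) 0" for e
    have h0: "0 \<le> h e" for e by (simp add: h_def)
    \<comment> \<open>Convexity of the positive part, for \<open>g\<close> with cell average
      \<open>X\<close>. The average is expressed through the product with \<open>q a' b'\<close>, so
      that empty cells are covered.\<close>
    have bid: "q a' b' * max (X - av \<delta> a' b') 0 \<le> (\<Sum>e\<in>cell a'. m e b' * h e)"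
      if "1 \<le> b'" "q a' b' * X = (\<Sum>e\<in>cell a'. m e b' * g e)"
        "\<And>e. e \<in> cell a' \<Longrightarrow> 0 < m e b' \<Longrightarrow> g e \<le> min (\<alpha> e) t" for a' b' X g
    proof -
      have "q a' b' * X - q a' b' * av \<delta> a' b' = (\<Sum>e\<in>cell a'. m e b' * (g e - \<delta> e))"
        unfolding that(2) qav[OF that(1)] by (simp add: algebra_simps sum_subtractf)
      also have "\<dots> \<le> (\<Sum>e\<in>cell a'. m e b' * h e)"
      proof (rule sum_mono)
        fix e assume e: "e \<in> cell a'"
        show "m e b' * (g e - \<delta> e) \<le> m e b' * h e"
        proof (cases "m e b' = 0")
          case False
          then have "0 < m e b'" using m0c[OF e that(1)] by simp
          then show ?thesis using that(3)[OF e] by (intro mult_left_mono) (auto simp: h_def)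
        qed simp
      qed
      finally have "q a' b' * (X - av \<delta> a' b') \<le> (\<Sum>e\<in>cell a'. m e b' * h e)"
        by (simp add: algebra_simps)
      moreover have "0 \<le> (\<Sum>e\<in>cell a'. m e b' * h e)"
        using m0c[OF _ that(1)] h0 by (intro sum_nonneg) auto
      ultimately show ?thesis by (simp add: max_def)
    qed
    have early: "q a' b' * max (av \<alpha> a' b' - av \<delta> a' b') 0 \<le> (\<Sum>e\<in>cell a'. m e b' * h e)"
      if "a' \<in> {a+1..n}" "b' \<in> {1..a}" for a' b'
    proof (rule bid[where g = \<alpha>])
      show "\<alpha> e \<le> min (\<alpha> e) t" if "e \<in> cell a'" "0 < m e b'" for e
        using le_lo[of e b' "a + 1"] cellS[OF that(1)] that(2) \<open>b' \<in> {1..a}\<close> a by (simp add: t_def)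
    qed (use that qav in auto)
    have T: "av \<alpha> a a \<le> t" unfolding t_def using a by (intro av_\<alpha>_le) auto
    have late: "q a' b' * max (av \<alpha> a a - av \<delta> a' b') 0 \<le> (\<Sum>e\<in>cell a'. m e b' * h e)"
      if "a' \<in> {a+1..n}" "b' \<in> {a+1..a'}" for a' b'
    proof (rule bid[where g = "\<lambda>_. av \<alpha> a a"])
      show "av \<alpha> a a \<le> min (\<alpha> e) t" if "e \<in> cell a'" "0 < m e b'" for e
      proof -
        have "t \<le> lo b'" unfolding t_def using \<open>a' \<in> {a+1..n}\<close> \<open>b' \<in> {a+1..a'}\<close> by (intro lo_mono) auto
        then show ?thesis using T lo_le[OF cellS(1)[OF that(1)] that(2)] by simp
      qed
    qed (use that in \<open>auto simp: q_def sum_distrib_right\<close>)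
    have "(\<Sum>a'\<in>{a+1..n}. \<Sum>b'\<in>{1..a}. q a' b' * max (av \<alpha> a' b' - av \<delta> a' b') 0) +
          (\<Sum>a'\<in>{a+1..n}. \<Sum>b'\<in>{a+1..a'}. q a' b' * max (av \<alpha> a a - av \<delta> a' b') 0)
        \<le> (\<Sum>a'\<in>{a+1..n}. \<Sum>b'\<in>{1..a}. \<Sum>e\<in>cell a'. m e b' * h e) +
          (\<Sum>a'\<in>{a+1..n}. \<Sum>b'\<in>{a+1..a'}. \<Sum>e\<in>cell a'. m e b' * h e)"
    proof (rule add_mono)
      show "(\<Sum>a'\<in>{a+1..n}. \<Sum>b'\<in>{1..a}. q a' b' * max (av \<alpha> a' b' - av \<delta> a' b') 0)
        \<le> (\<Sum>a'\<in>{a+1..n}. \<Sum>b'\<in>{1..a}. \<Sum>e\<in>cell a'. m e b' * h e)"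
        by (rule sum_mono, rule sum_mono, rule early)
      show "(\<Sum>a'\<in>{a+1..n}. \<Sum>b'\<in>{a+1..a'}. q a' b' * max (av \<alpha> a a - av \<delta> a' b') 0)
        \<le> (\<Sum>a'\<in>{a+1..n}. \<Sum>b'\<in>{a+1..a'}. \<Sum>e\<in>cell a'. m e b' * h e)"
        by (rule sum_mono, rule sum_mono, rule late)
    qed
    also have "\<dots> = (\<Sum>a'\<in>{a+1..n}. \<Sum>b'\<in>{1..a'}. \<Sum>e\<in>cell a'. m e b' * h e)"
      unfolding sum.distrib[symmetric]
    proof (rule sum.cong[OF refl])
      fix a' assume "a' \<in> {a+1..n}"
      then have "a \<le> a'" by simp
      then obtain p where p: "a' = a + p" using le_Suc_ex by blast
      show "(\<Sum>b'\<in>{1..a}. \<Sum>e\<in>cell a'. m e b' * h e) + (\<Sum>b'\<in>{a+1..a'}. \<Sum>e\<in>cell a'. m e b' * h e)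
          = (\<Sum>b'\<in>{1..a'}. \<Sum>e\<in>cell a'. m e b' * h e)"
        unfolding p by (rule sum.ub_add_nat[symmetric]) simp
    qed
    also have "\<dots> \<le> (\<Sum>a'\<in>{a+1..n}. \<Sum>b'\<in>{1..n}. \<Sum>e\<in>cell a'. m e b' * h e)"
      by (rule sum_mono, rule sum_mono2) (auto intro!: sum_nonneg mult_nonneg_nonneg m0c h0)
    also have "\<dots> = (\<Sum>a'\<in>{a+1..n}. \<Sum>e\<in>cell a'. w e * h e)"
    proof (rule sum.cong[OF refl])
      fix a'
      have "(\<Sum>b'\<in>{1..n}. \<Sum>e\<in>cell a'. m e b' * h e) = (\<Sum>e\<in>cell a'. \<Sum>b'\<in>{1..n}. m e b' * h e)"
        by (rule sum.swap)
      also have "\<dots> = (\<Sum>e\<in>cell a'. w e * h e)"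
        using m_w cellS by (intro sum.cong) (auto simp flip: sum_distrib_right)
      finally show "(\<Sum>b'\<in>{1..n}. \<Sum>e\<in>cell a'. m e b' * h e) = (\<Sum>e\<in>cell a'. w e * h e)" .
    qed
    also have "\<dots> = (\<Sum>a'\<in>{a+1..n}. \<Sum>e\<in>{e\<in>{e\<in>S. a < A e}. A e = a'}. w e * h e)"
      by (intro sum.cong) (auto simp: cell_def)
    also have "\<dots> = (\<Sum>e\<in>{e\<in>S. a < A e}. w e * h e)"
      using fin A_range by (intro sum.group) fastforce+
    also have "\<dots> \<le> (\<Sum>e\<in>{e\<in>S. t \<le> \<theta> e}. w e * h e)"
    proof (rule sum_mono2)
      show "{e\<in>S. a < A e} \<subseteq> {e\<in>S. t \<le> \<theta> e}"
      proof
        fix e assume "e \<in> {e\<in>S. a < A e}"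
        then have "e \<in> S" "a + 1 \<le> A e" by auto
        then have "lo (a + 1) \<le> lo (A e)" using A_range by (intro lo_mono) auto
        then show "e \<in> {e\<in>S. t \<le> \<theta> e}" using lo_A \<open>e \<in> S\<close> unfolding t_def by fastforce
      qed
    qed (use fin pos h0 in \<open>auto intro!: mult_nonneg_nonneg intro: less_imp_le\<close>)
    \<comment> \<open>The budget is available at \<open>t\<close> because the start of a chunk is a
      value of \<open>\<alpha>\<close> and hence at least \<open>y\<close>.\<close>
    also have "\<dots> \<le> real K * f"
      unfolding h_def t_def using a by (intro bids y_lo) auto
    finally show ?thesis .
  qed

  \<comment> \<open>The average of \<open>\<alpha>\<close> also serves as \<open>\<beta>\<close>,
    matching the right-hand side \<open>\<alpha> + \<delta> + \<delta>'\<close> of the star's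
    triangle condition.\<close>
  have "frp_feasible K n f q (av \<alpha>) (av \<delta>) (av \<alpha>)"
    unfolding frp_feasible_def
  proof (intro conjI ballI impI)
    show "0 \<le> f" by fact
    show "0 \<le> q a b" "0 \<le> av \<alpha> a b" "0 \<le> av \<delta> a b" "0 \<le> av \<alpha> a b"
      if "a \<in> {1..n}" "b \<in> {1..a}" for a b
      using that q0[of b a] av_\<delta>_0[of b a] av_\<delta>_\<alpha>[of b a] by auto
    show "av \<alpha> a b \<le> av \<alpha> a' b'"
      if "a \<in> {1..n}" "a' \<in> {1..n}" "b \<in> {1..a}" "b' \<in> {1..a'}" "b < b'" for a a' b b'
      using that av_\<alpha>_le[of b b' a] av_\<alpha>_ge[of b' a'] by auto
    show "av \<alpha> a' b' \<le> av \<alpha> a b + av \<delta> a b + av \<delta> a' b'"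
      if "a \<in> {1..n}" "a' \<in> {1..n}" "b \<in> {1..a}" "b' \<in> {1..a'}" "a < a'" for a a' b b'
      using that by (intro c_tri) auto
    show "av \<delta> a b \<le> av \<alpha> a b" if "a \<in> {1..n}" "b \<in> {1..a}" for a b
      using that av_\<delta>_\<alpha>[of b a] by auto
    show "f + (\<Sum>a\<in>{1..n}. \<Sum>b\<in>{1..a}. q a b * av \<delta> a b) \<le> 1"
      using budget sum_all[of \<delta>] by simp
    show "(\<Sum>a\<in>{b..n}. q a b) = 1" if "b \<in> {1..n}" for b
    proof -
      have "(\<Sum>a\<in>{b..n}. q a b) = (\<Sum>a\<in>{1..n}. \<Sum>e\<in>cell a. m e b)"
        unfolding q_def using that m_beyond cellS
        by (intro sum.mono_neutral_left) (auto intro!: sum.neutral)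
      then show ?thesis using sum_cells m_1[OF that] by simp
    qed
  qed (use c_bids in auto)
  then have "ereal (\<Sum>a\<in>{1..n}. \<Sum>b\<in>{1..a}. q a b * av \<alpha> a b) \<le> frp_Obj K n"
    unfolding frp_Obj_def by (intro Sup_upper) blast
  then show ?thesis unfolding sum_all .
qed


section \<open>The value of the program\<close>

text \<open>\<open>\<kappa>\<close> stands for the reciprocal of the cost, in a form that still
  makes sense at cost zero, where every positive factor is admissible.\<close>

lemma frp_Obj_ge:
  assumes sd: "star_data S w \<alpha> \<delta> \<theta> 0 (real K * f)" and "1 \<le> n" "0 \<le> f" "0 < \<kappa>"
    and budget: "\<kappa> * (f + (\<Sum>e\<in>S. w e * \<delta> e)) \<le> 1"
  shows "ereal (\<kappa> * (\<Sum>e\<in>S. w e * \<alpha> e)) \<le> frp_Obj K n"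
proof -
  obtain w' \<alpha>' \<delta>' y where sd': "star_data S w' \<alpha>' \<delta>' \<theta> y (real K * f)"
    and y: "\<And>e. e \<in> S \<Longrightarrow> y \<le> \<alpha>' e" "\<And>e. e \<in> S \<Longrightarrow> \<alpha>' e - \<delta>' e \<le> 2 * y"
    and same: "\<And>e. e \<in> S \<Longrightarrow> w' e * \<alpha>' e = w e * \<alpha> e" "\<And>e. e \<in> S \<Longrightarrow> w' e * \<delta>' e = w e * \<delta> e"
    using star_data_raise[OF sd] by metis
  have "0 < sum w' S"
    using sd' by (intro sum_pos) (auto simp: star_data_def)
  \<comment> \<open>\<open>\<rho>\<close> makes the raised total weight exactly \<open>n\<close>;
    \<open>\<sigma>\<close> then compensates so that cost and objective are scaled by
    \<open>\<kappa>\<close>.\<close>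
  define \<rho> where "\<rho> = real n / sum w' S"
  define \<sigma> where "\<sigma> = \<kappa> / \<rho>"
  have "0 < \<rho>" using \<open>0 < sum w' S\<close> \<open>1 \<le> n\<close> by (simp add: \<rho>_def)
  then have "0 < \<sigma>" and \<rho>\<sigma>: "\<rho> * \<sigma> = \<kappa>" using \<open>0 < \<kappa>\<close> by (simp_all add: \<sigma>_def)
  have scaled: "(\<Sum>e\<in>S. \<rho> * w' e * (\<sigma> * g e)) = \<kappa> * (\<Sum>e\<in>S. w' e * g e)" for g
    unfolding sum_distrib_left \<rho>\<sigma>[symmetric] by (intro sum.cong) auto
  have "star_data S (\<lambda>e. \<rho> * w' e) (\<lambda>e. \<sigma> * \<alpha>' e) (\<lambda>e. \<sigma> * \<delta>' e) (\<lambda>e. \<sigma> * \<theta> e)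
          (\<sigma> * y) (real K * (\<kappa> * f))"
    using star_data_scale[OF sd' \<open>0 < \<rho>\<close> \<open>0 < \<sigma>\<close>] unfolding \<rho>\<sigma> by (simp add: algebra_simps)
  then have "ereal (\<Sum>e\<in>S. \<rho> * w' e * (\<sigma> * \<alpha>' e)) \<le> frp_Obj K n"
  proof (rule frp_Obj_ge_star)
    show "\<sigma> * y \<le> \<sigma> * \<alpha>' e" if "e \<in> S" for e
      using y(1)[OF that] \<open>0 < \<sigma>\<close> by simp
    show "\<sigma> * \<alpha>' e - \<sigma> * \<delta>' e \<le> 2 * (\<sigma> * y)" if "e \<in> S" for e
      using mult_left_mono[OF y(2)[OF that], of \<sigma>] \<open>0 < \<sigma>\<close> by (simp add: algebra_simps)
    show "(\<Sum>e\<in>S. \<rho> * w' e) = real n"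
      unfolding sum_distrib_left[symmetric] using \<open>0 < sum w' S\<close> by (simp add: \<rho>_def)
    show "0 \<le> \<kappa> * f" using \<open>0 \<le> f\<close> \<open>0 < \<kappa>\<close> by simp
    show "\<kappa> * f + (\<Sum>e\<in>S. \<rho> * w' e * (\<sigma> * \<delta>' e)) \<le> 1"
      unfolding scaled using budget same(2) by (simp add: algebra_simps cong: sum.cong)
  qed
  then show ?thesis unfolding scaled using same(1) by (simp cong: sum.cong)
qed

text \<open>Keeps the infimum finite. The budget gives \<open>f \<le> 1\<close> and
  \<open>\<delta> 2 2 \<le> 1\<close>, the bid constraint then
  \<open>\<alpha> 1 1 \<le> K + 1\<close>, and the triangle constraint
  \<open>\<alpha> 2 2 \<le> 2 * K + 3\<close>, which bounds every other \<open>\<alpha>\<close>; the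
  total mass is 2.\<close>

lemma frp_Obj_2_le: "frp_Obj K 2 \<le> ereal (4 * real K + 6)"
  unfolding frp_Obj_def
proof (rule Sup_least, safe)
  fix f q \<alpha> \<delta> \<beta>
  assume feas: "frp_feasible K 2 f q \<alpha> \<delta> \<beta>"
  have two: "{Suc 0..2} = {Suc 0, 2}" "{Suc 0..<2} = {Suc 0}" "{Suc (Suc 0)..2} = {2}" by auto
  have nonneg: "0 \<le> f" "0 \<le> q 1 1" "0 \<le> q 2 1" "0 \<le> q 2 2" "0 \<le> \<delta> 1 1" "0 \<le> \<delta> 2 1" "0 \<le> \<delta> 2 2"
    and mono: "\<alpha> 1 1 \<le> \<alpha> 2 2" "\<alpha> 2 1 \<le> \<alpha> 2 2"
    and tri: "\<alpha> 2 2 \<le> \<beta> 1 1 + \<delta> 1 1 + \<delta> 2 2"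
    and le: "\<delta> 1 1 \<le> \<alpha> 1 1" "\<beta> 1 1 \<le> \<alpha> 1 1"
    and bid: "q 2 1 * max (\<alpha> 2 1 - \<delta> 2 1) 0 + q 2 2 * max (\<alpha> 1 1 - \<delta> 2 2) 0 \<le> real K * f"
    and budget: "f + (q 1 1 * \<delta> 1 1 + (q 2 1 * \<delta> 2 1 + q 2 2 * \<delta> 2 2)) \<le> 1"
    and mass: "q 1 1 + q 2 1 = 1" "q 2 2 = 1"
    using feas unfolding frp_feasible_def by (auto simp: two)
  have "0 \<le> q 1 1 * \<delta> 1 1" "0 \<le> q 2 1 * \<delta> 2 1" using nonneg by auto
  then have "f \<le> 1" "\<delta> 2 2 \<le> 1" using budget nonneg(1,7) unfolding mass(2) by linarith+
  have "0 \<le> q 2 1 * max (\<alpha> 2 1 - \<delta> 2 1) 0" using nonneg by simp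
  then have "\<alpha> 1 1 \<le> real K * f + \<delta> 2 2" using bid mass by simp
  also have "\<dots> \<le> real K + 1"
    using \<open>f \<le> 1\<close> \<open>\<delta> 2 2 \<le> 1\<close> mult_left_mono[of f 1 "real K"] by simp
  finally have \<alpha>22: "\<alpha> 2 2 \<le> 2 * real K + 3" using tri le \<open>\<delta> 2 2 \<le> 1\<close> by simp
  have "q 1 1 * \<alpha> 1 1 + q 2 1 * \<alpha> 2 1 \<le> q 1 1 * \<alpha> 2 2 + q 2 1 * \<alpha> 2 2"
    using mono nonneg by (intro add_mono mult_left_mono) auto
  also have "\<dots> = \<alpha> 2 2" using mass by (simp flip: distrib_right)
  finally show "ereal (\<Sum>a\<in>{1..2}. \<Sum>b\<in>{1..a}. q a b * \<alpha> a b) \<le> ereal (4 * real K + 6)"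
    using \<alpha>22 mass by (simp add: two)
qed

lemma Gamma_SFR_eq_real:
  obtains g where "Gamma_SFR K = ereal g" "1 \<le> g"
proof -
  \<comment> \<open>One edge whose value equals its distance to a free facility: objective and cost
    are both 1, for every \<open>n\<close>.\<close>
  have "star_data {()} (\<lambda>_. 1) (\<lambda>_. 1) (\<lambda>_. 1) (\<lambda>_. 1) 0 (real K * 0)"
    by (auto simp: star_data_def)
  from frp_Obj_ge[OF this, of _ 1] have "1 \<le> frp_Obj K n" if "1 \<le> n" for n
    using that by (simp add: one_ereal_def)
  then have "1 \<le> Gamma_SFR K"
    unfolding Gamma_SFR_def by (intro INF_greatest) auto
  moreover have "Gamma_SFR K \<le> ereal (4 * real K + 6)"
    unfolding Gamma_SFR_def using frp_Obj_2_le by (rule INF_lower2[rotated]) simp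
  ultimately show thesis
    by (cases "Gamma_SFR K") (auto intro: that simp: one_ereal_def)
qed

text \<open>Homogeneity removes the normalisation. A positive cost \<open>c\<close> is scaled by
  \<open>1 / c\<close>; if \<open>c = 0\<close>, arbitrarily large factors are admissible, so a
  positive objective would exceed \<open>g\<close>.\<close>

lemma star_data_bound:
  assumes sd: "star_data S w \<alpha> \<delta> \<theta> 0 (real K * f)" and "0 \<le> f" and g: "Gamma_SFR K = ereal g" "1 \<le> g"
  shows "(\<Sum>e\<in>S. w e * \<alpha> e) \<le> g * (f + (\<Sum>e\<in>S. w e * \<delta> e))"
proof -
  define P c where "P = (\<Sum>e\<in>S. w e * \<alpha> e)" and "c = f + (\<Sum>e\<in>S. w e * \<delta> e)"
  have "0 \<le> c"
    unfolding c_def using sd \<open>0 \<le> f\<close>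
    by (intro add_nonneg_nonneg sum_nonneg) (auto simp: star_data_def intro!: mult_nonneg_nonneg intro: less_imp_le)
  have bound: "\<kappa> * P \<le> g" if "0 < \<kappa>" "\<kappa> * c \<le> 1" for \<kappa>
  proof -
    have "ereal (\<kappa> * P) \<le> Gamma_SFR K"
      unfolding Gamma_SFR_def P_def
      using frp_Obj_ge[OF sd _ \<open>0 \<le> f\<close> that(1)] that(2) unfolding c_def by (intro INF_greatest) auto
    then show ?thesis using g by simp
  qed
  have "P \<le> g * c"
  proof (cases "c = 0")
    case True
    show ?thesis
    proof (rule ccontr)
      assume "\<not> ?thesis"
      then have "0 < P" using True by simp
      then show False using bound[of "(g + 1) / P"] True g by simp
    qed
  next
    case False
    then show ?thesis using bound[of "1 / c"] \<open>0 \<le> c\<close> by (simp add: field_simps)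
  qed
  then show ?thesis by (simp add: P_def c_def)
qed


section \<open>Invariants of the algorithm\<close>

text \<open>An upper bound for what the hyperedge has contributed to openings. \<open>alpha\<close>
  is frozen once a location is assigned, so the surplus can be read off later; an opening that
  assigns several locations charges only one surplus.\<close>

definition paid :: "nat \<Rightarrow> lflp \<Rightarrow> gstate \<Rightarrow> (nat \<Rightarrow> nat) \<Rightarrow> real" where
  "paid K I st e =
     (\<Sum>L\<in>{1..K}. case psi st e L of None \<Rightarrow> 0 | Some i \<Rightarrow> alpha st e - dst I (e L) i)"

section \<open>Elementary facts on bids and distances\<close>

lemma finite_hyperedges: "finite (hyperedges K I)"
  by (simp add: hyperedges_def finite_PiE)

definition chances :: "nat \<Rightarrow> gstate \<Rightarrow> (nat \<Rightarrow> nat) \<Rightarrow> nat set" where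
  "chances K st e = {L\<in>{1..K}. psi st e L = None}"

lemma later_bid_eq:
  "later_bid K I st e i =
     (if chances K st e = {} then 0
      else max (alpha st e - Min ((\<lambda>L. dst I (e L) i) ` chances K st e)) 0)"
  by (simp only: later_bid_def Let_def chances_def)

lemma finite_chances: "finite (chances K st e)"
  by (simp add: chances_def)

text \<open>An active hyperedge still has all its chances, so its minimum over them is
  \<open>edist\<close> and both halves of the total bid take the same form.\<close>

lemma total_bid_eq_later_bids:
  assumes "1 \<le> K" "active st \<subseteq> hyperedges K I" "\<And>e L. e \<in> active st \<Longrightarrow> psi st e L = None"
  shows "total_bid K I st i = (\<Sum>e\<in>hyperedges K I. tau I e * later_bid K I st e i)"
proof -
  have "later_bid K I st e i = max (alpha st e - edist K I e i) 0" if "e \<in> active st" for e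
  proof -
    have "chances K st e = {1..K}" using assms(3)[OF that] by (auto simp: chances_def)
    then show ?thesis using assms(1) by (simp add: later_bid_eq edist_def)
  qed
  then have "total_bid K I st i = (\<Sum>e\<in>active st. tau I e * later_bid K I st e i) +
      (\<Sum>e\<in>hyperedges K I - active st. tau I e * later_bid K I st e i)"
    by (simp add: total_bid_def)
  also have "\<dots> = (\<Sum>e\<in>hyperedges K I. tau I e * later_bid K I st e i)"
    by (subst sum.subset_diff[OF assms(2) finite_hyperedges]) simp
  finally show ?thesis .
qed

lemma later_bid_nonneg: "0 \<le> later_bid K I st e i"
  by (simp add: later_bid_eq)

lemma later_bid_ge:
  assumes "L \<in> {1..K}" "psi st e L = None"
  shows "alpha st e - dst I (e L) i \<le> later_bid K I st e i"
proof -
  have L: "L \<in> chances K st e" using assms by (simp add: chances_def)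
  then have "Min ((\<lambda>L. dst I (e L) i) ` chances K st e) \<le> dst I (e L) i"
    using finite_chances by (intro Min_le) auto
  then show ?thesis using L by (auto simp: later_bid_eq)
qed

lemma later_bid_cases:
  obtains "later_bid K I st e i = 0"
  | L where "L \<in> {1..K}" "psi st e L = None" "dst I (e L) i \<le> alpha st e"
      "later_bid K I st e i = alpha st e - dst I (e L) i"
proof -
  show thesis
  proof (cases "later_bid K I st e i = 0")
    case False
    define C where "C = chances K st e"
    have bid: "later_bid K I st e i = max (alpha st e - Min ((\<lambda>L. dst I (e L) i) ` C)) 0" and "C \<noteq> {}"
      using False by (auto simp: later_bid_eq C_def split: if_splits)
    then have "Min ((\<lambda>L. dst I (e L) i) ` C) \<in> (\<lambda>L. dst I (e L) i) ` C"
      using finite_chances by (intro Min_in) (auto simp: C_def)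
    then obtain L where L: "L \<in> C" "Min ((\<lambda>L. dst I (e L) i) ` C) = dst I (e L) i" by auto
    then have "later_bid K I st e i = alpha st e - dst I (e L) i" "dst I (e L) i \<le> alpha st e"
      using bid False by (auto simp: max_def split: if_splits)
    then show thesis using L(1) that(2)[of L] by (auto simp: C_def chances_def)
  qed (rule that(1))
qed

lemma edist_le: "L \<in> {1..K} \<Longrightarrow> edist K I e i \<le> dst I (e L) i"
  unfolding edist_def by (intro Min_le) auto

lemma edist_attained:
  assumes "1 \<le> K"
  obtains L where "L \<in> {1..K}" "edist K I e i = dst I (e L) i"
proof -
  have "edist K I e i \<in> (\<lambda>L. dst I (e L) i) ` {1..K}"
    unfolding edist_def using assms by (intro Min_in) auto
  then show thesis using that by auto
qed

text \<open>
  \<open>T\<close> is the elapsed time and \<open>\<theta> e L\<close> the time at which \<open>psi e L\<close> was assigned. In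
  \<open>past_bids\<close>, the function \<open>Ls\<close> picks one location of each hyperedge, later the one that is
  closest to a facility of the optimal solution; at any earlier time \<open>t\<close> the hyperedges whose
  picked location was still unassigned did not overpay for \<open>i\<close>.
\<close>

locale greedy_inv =
  fixes K :: nat and I :: lflp and st :: gstate and T :: real and \<theta> :: "(nat \<Rightarrow> nat) \<Rightarrow> nat \<Rightarrow> real"
  assumes K_pos: "1 \<le> K" and inst: "lflp_instance K I"
    and T_nonneg: "0 \<le> T"
    and active_sub: "active st \<subseteq> hyperedges K I"
    and sol_sub: "sol st \<subseteq> locs I"
    and active_alpha: "e \<in> active st \<Longrightarrow> alpha st e = T"
    and active_psi: "e \<in> active st \<Longrightarrow> psi st e L = None"
    and alpha_range: "e \<in> hyperedges K I \<Longrightarrow> 0 \<le> alpha st e \<and> alpha st e \<le> T"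
    and inactive_psi: "e \<in> hyperedges K I \<Longrightarrow> e \<notin> active st \<Longrightarrow> \<exists>L\<in>{1..K}. psi st e L \<noteq> None"
    and unset: "e \<in> hyperedges K I \<Longrightarrow> L \<in> {1..K} \<Longrightarrow> i \<in> sol st \<Longrightarrow> psi st e L = None \<Longrightarrow>
      alpha st e \<le> dst I (e L) i"
    and set: "e \<in> hyperedges K I \<Longrightarrow> L \<in> {1..K} \<Longrightarrow> psi st e L = Some i \<Longrightarrow>
      i \<in> sol st \<and> dst I (e L) i \<le> alpha st e \<and> alpha st e \<le> \<theta> e L \<and> \<theta> e L \<le> T"
    and set_before: "e \<in> hyperedges K I \<Longrightarrow> L \<in> {1..K} \<Longrightarrow> e' \<in> hyperedges K I \<Longrightarrow> L' \<in> {1..K} \<Longrightarrow>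
      psi st e L = Some i \<Longrightarrow> psi st e' L' = Some i' \<Longrightarrow> \<theta> e L < \<theta> e' L' \<Longrightarrow>
      alpha st e' \<le> dst I (e' L') i"
    and bids: "i \<in> locs I \<Longrightarrow> i \<notin> sol st \<Longrightarrow> total_bid K I st i \<le> real K * fcost I i"
    and past_bids: "Ls \<in> hyperedges K I \<rightarrow> {1..K} \<Longrightarrow> i \<in> locs I \<Longrightarrow> 0 \<le> t \<Longrightarrow> t \<le> T \<Longrightarrow>
      (\<Sum>e\<in>{e\<in>hyperedges K I. psi st e (Ls e) = None \<or> t \<le> \<theta> e (Ls e)}.
         tau I e * max (min (alpha st e) t - dst I (e (Ls e)) i) 0) \<le> real K * fcost I i"
    and payments: "real K * (\<Sum>i\<in>sol st. fcost I i) \<le> (\<Sum>e\<in>hyperedges K I. tau I e * paid K I st e)"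
begin

section \<open>Preservation of the invariants by events and by waiting\<close>

lemma metric: "Metric_space (locs I) (dst I)"
  using inst by (simp add: lflp_instance_def)

lemma dst_nonneg: "0 \<le> dst I x y"
  using Metric_space.nonneg[OF metric] .

lemma tau_nonneg: "e \<in> hyperedges K I \<Longrightarrow> 0 \<le> tau I e"
  using inst by (simp add: lflp_instance_def)

lemma fcost_nonneg: "i \<in> locs I \<Longrightarrow> 0 \<le> fcost I i"
  using inst by (simp add: lflp_instance_def)

lemma finite_sol: "finite (sol st)"
  using sol_sub finite_subset by blast

lemma total_bid_eq: "total_bid K I st i = (\<Sum>e\<in>hyperedges K I. tau I e * later_bid K I st e i)"
  using K_pos active_sub active_psi by (rule total_bid_eq_later_bids)

text \<open>Covers both kinds of events; a connection is the case \<open>i \<in> sol st\<close>.\<close>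

lemma greedy_inv_event:
  assumes i: "i \<in> locs I"
    and alpha': "alpha st' = alpha st" and sol': "sol st' = insert i (sol st)"
    and active': "active st' \<subseteq> active st"
    and new: "\<And>e L. psi st' e L \<noteq> psi st e L \<Longrightarrow> psi st e L = None \<and> psi st' e L = Some i \<and>
      dst I (e L) i \<le> alpha st e \<and> e \<notin> active st'"
    and removed: "\<And>e. e \<in> active st \<Longrightarrow> e \<notin> active st' \<Longrightarrow> \<exists>L\<in>{1..K}. psi st' e L \<noteq> None"
    and unset': "\<And>e L. e \<in> hyperedges K I \<Longrightarrow> L \<in> {1..K} \<Longrightarrow> psi st' e L = None \<Longrightarrow>
      alpha st e \<le> dst I (e L) i"
    and opened: "i \<notin> sol st \<Longrightarrow> total_bid K I st i = real K * fcost I i"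
    and opened': "\<And>e L. i \<notin> sol st \<Longrightarrow> e \<in> hyperedges K I \<Longrightarrow> L \<in> {1..K} \<Longrightarrow> psi st e L = None \<Longrightarrow>
      dst I (e L) i \<le> alpha st e \<Longrightarrow> psi st' e L = Some i"
  shows "greedy_inv K I st' T (\<lambda>e L. if psi st e L = None then T else \<theta> e L)"
proof -
  \<comment> \<open>Pairs unset before the event get the current time. For those that stay unset the
    value is harmless: each invariant on \<open>\<theta>\<close> either asks for an assignment or
    admits unset pairs anyway.\<close>
  define \<theta>' where "\<theta>' = (\<lambda>e L. if psi st e L = None then T else \<theta> e L)"
  have old: "psi st' e L = Some j" if "psi st e L = Some j" for e L j
    using new[of e L] that by fastforce
  have psi'_cases: "psi st e L = Some j \<or> psi st e L = None \<and> j = i \<and> dst I (e L) i \<le> alpha st e"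
    if "psi st' e L = Some j" for e L j
    using new[of e L] that by (cases "psi st' e L = psi st e L") auto
  have active_psi': "psi st' e L = None" if "e \<in> active st'" for e L
    using new[of e L] active_psi[of e L] active' that by fastforce
  have term_mono: "(case psi st e L of None \<Rightarrow> 0 | Some j \<Rightarrow> alpha st e - dst I (e L) j)
      \<le> (case psi st' e L of None \<Rightarrow> 0 | Some j \<Rightarrow> alpha st' e - dst I (e L) j)" for e L
    using psi'_cases[of e L] old[of e L] by (auto simp: alpha' split: option.splits)
  have paid_mono: "paid K I st e \<le> paid K I st' e" for e
    unfolding paid_def by (intro sum_mono term_mono)
  \<comment> \<open>Chances only disappear while \<open>alpha\<close> is unchanged, so bids can only
    drop.\<close>
  have later_mono: "later_bid K I st' e j \<le> later_bid K I st e j" if "e \<in> hyperedges K I" for e j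
  proof (cases rule: later_bid_cases[of K I st' e j])
    case 1
    then show ?thesis using later_bid_nonneg by simp
  next
    case (2 L)
    then have "psi st e L = None" using old[of e L] by (cases "psi st e L") auto
    then show ?thesis using 2 later_bid_ge[of L K st e I j] by (simp add: alpha')
  qed
  show ?thesis unfolding \<theta>'_def[symmetric]
  proof
    show "1 \<le> K" "lflp_instance K I" "0 \<le> T"
      using K_pos inst T_nonneg by auto
    show "active st' \<subseteq> hyperedges K I" using active' active_sub by blast
    show "sol st' \<subseteq> locs I" using i sol' sol_sub by auto
    show "alpha st' e = T" if "e \<in> active st'" for e
      using that active' active_alpha by (auto simp: alpha')
    show "psi st' e L = None" if "e \<in> active st'" for e L
      using active_psi'[OF that] .
    show "0 \<le> alpha st' e \<and> alpha st' e \<le> T" if "e \<in> hyperedges K I" for e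
      using alpha_range[OF that] by (simp add: alpha')
    show "\<exists>L\<in>{1..K}. psi st' e L \<noteq> None" if e: "e \<in> hyperedges K I" "e \<notin> active st'" for e
    proof (cases "e \<in> active st")
      case True
      then show ?thesis using removed e by blast
    next
      case False
      then obtain L j where "L \<in> {1..K}" "psi st e L = Some j" using inactive_psi e by blast
      then show ?thesis using old by blast
    qed
    show "alpha st' e \<le> dst I (e L) j"
      if "e \<in> hyperedges K I" "L \<in> {1..K}" "j \<in> sol st'" "psi st' e L = None" for e L j
    proof -
      have "psi st e L = None" using old[of e L] that(4) by (cases "psi st e L") auto
      then show ?thesis using that unset unset' by (auto simp: alpha' sol')
    qed
    show "j \<in> sol st' \<and> dst I (e L) j \<le> alpha st' e \<and> alpha st' e \<le> \<theta>' e L \<and> \<theta>' e L \<le> T"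
      if "e \<in> hyperedges K I" "L \<in> {1..K}" "psi st' e L = Some j" for e L j
      using psi'_cases[OF that(3)] set[OF that(1,2), of j] alpha_range[OF that(1)]
      by (auto simp: alpha' sol' \<theta>'_def)
    show "alpha st' e' \<le> dst I (e' L') j"
      if e: "e \<in> hyperedges K I" "L \<in> {1..K}" "e' \<in> hyperedges K I" "L' \<in> {1..K}"
        "psi st' e L = Some j" "psi st' e' L' = Some j'" "\<theta>' e L < \<theta>' e' L'" for e L e' L' j j'
    proof -
      have "\<theta>' e' L' \<le> T"
        using set[OF e(3,4)] by (auto simp: \<theta>'_def)
      \<comment> \<open>A time strictly below one that is at most \<open>T\<close> belongs to a pair
        set before this event. If the other pair is set only now, it was unset while
        \<open>j\<close> was already open, and \<open>unset\<close> gives the distance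
        bound.\<close>
      then have L: "psi st e L = Some j"
        using e(5,7) psi'_cases[of e L j] by (auto simp: \<theta>'_def)
      show ?thesis
      proof (cases "psi st e' L'")
        case None
        then show ?thesis using unset[OF e(3,4)] set[OF e(1,2) L] by (simp add: alpha')
      next
        case (Some j'')
        then show ?thesis using set_before[OF e(1-4) L] e(7) L by (simp add: alpha' \<theta>'_def)
      qed
    qed
    show "total_bid K I st' j \<le> real K * fcost I j" if "j \<in> locs I" "j \<notin> sol st'" for j
    proof -
      have "total_bid K I st' j = (\<Sum>e\<in>hyperedges K I. tau I e * later_bid K I st' e j)"
        using K_pos active' active_sub active_psi' by (intro total_bid_eq_later_bids) auto
      also have "\<dots> \<le> total_bid K I st j"
        unfolding total_bid_eq using tau_nonneg later_mono by (intro sum_mono mult_left_mono)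
      also have "\<dots> \<le> real K * fcost I j"
        using that by (intro bids) (auto simp: sol')
      finally show ?thesis .
    qed
    show "(\<Sum>e\<in>{e\<in>hyperedges K I. psi st' e (Ls e) = None \<or> t \<le> \<theta>' e (Ls e)}.
         tau I e * max (min (alpha st' e) t - dst I (e (Ls e)) j) 0) \<le> real K * fcost I j"
      if "Ls \<in> hyperedges K I \<rightarrow> {1..K}" "j \<in> locs I" "0 \<le> t" "t \<le> T" for Ls j t
    proof -
      \<comment> \<open>A pair assigned now has time \<open>T \<ge> t\<close>, so it stays in the
        index set of the sum.\<close>
      have "psi st' e L = None \<or> t \<le> \<theta>' e L \<longleftrightarrow> psi st e L = None \<or> t \<le> \<theta> e L" for e L
        using old[of e L] \<open>t \<le> T\<close> by (cases "psi st e L") (auto simp: \<theta>'_def)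
      then show ?thesis using past_bids[OF that] by (simp add: alpha')
    qed
    show "real K * (\<Sum>i\<in>sol st'. fcost I i) \<le> (\<Sum>e\<in>hyperedges K I. tau I e * paid K I st' e)"
    proof (cases "i \<in> sol st")
      case True
      have "(\<Sum>e\<in>hyperedges K I. tau I e * paid K I st e) \<le> (\<Sum>e\<in>hyperedges K I. tau I e * paid K I st' e)"
        using tau_nonneg paid_mono by (intro sum_mono mult_left_mono)
      then show ?thesis using True payments by (simp add: sol' insert_absorb)
    next
      case False
      \<comment> \<open>A positive bid is the surplus of a single unset location within reach. The
        opening assigns that location, and the other terms of \<open>paid\<close> do not
        decrease.\<close>
      have pays: "paid K I st e + later_bid K I st e i \<le> paid K I st' e" if e: "e \<in> hyperedges K I" for e
      proof (cases rule: later_bid_cases[of K I st e i])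
        case 1
        then show ?thesis using paid_mono by simp
      next
        case (2 L)
        then have "psi st' e L = Some i" using opened' False e by blast
        then have "paid K I st' e = (alpha st e - dst I (e L) i) + (\<Sum>L\<in>{1..K} - {L}.
            case psi st' e L of None \<Rightarrow> 0 | Some j \<Rightarrow> alpha st' e - dst I (e L) j)"
          unfolding paid_def using 2(1) by (simp add: sum.remove[of _ L] alpha')
        moreover have "paid K I st e = (\<Sum>L\<in>{1..K} - {L}.
            case psi st e L of None \<Rightarrow> 0 | Some j \<Rightarrow> alpha st e - dst I (e L) j)"
          unfolding paid_def using 2(1,2) by (simp add: sum.remove[of _ L])
        moreover have "(\<Sum>L\<in>{1..K} - {L}. case psi st e L of None \<Rightarrow> 0 | Some j \<Rightarrow> alpha st e - dst I (e L) j)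
          \<le> (\<Sum>L\<in>{1..K} - {L}. case psi st' e L of None \<Rightarrow> 0 | Some j \<Rightarrow> alpha st' e - dst I (e L) j)"
          by (intro sum_mono term_mono)
        ultimately show ?thesis using 2(4) by linarith
      qed
      have "real K * (\<Sum>i\<in>sol st'. fcost I i) = real K * (\<Sum>i\<in>sol st. fcost I i) + total_bid K I st i"
        using False finite_sol opened by (simp add: sol' algebra_simps)
      also have "\<dots> \<le> (\<Sum>e\<in>hyperedges K I. tau I e * paid K I st e) + total_bid K I st i"
        using payments by simp
      also have "\<dots> = (\<Sum>e\<in>hyperedges K I. tau I e * (paid K I st e + later_bid K I st e i))"
        unfolding total_bid_eq by (simp add: sum.distrib distrib_left)
      also have "\<dots> \<le> (\<Sum>e\<in>hyperedges K I. tau I e * paid K I st' e)"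
        using tau_nonneg pays by (intro sum_mono mult_left_mono)
      finally show ?thesis .
    qed
  qed
qed

lemma greedy_inv_connect:
  assumes ev: "connect_event K I st e i"
  shows "greedy_inv K I (connect K I st e i) T (\<lambda>e L. if psi st e L = None then T else \<theta> e L)"
proof (rule greedy_inv_event)
  have e: "e \<in> active st" "i \<in> sol st" "alpha st e = edist K I e i"
    using ev by (auto simp: connect_event_def)
  show "i \<in> locs I" "sol (connect K I st e i) = insert i (sol st)"
    using e sol_sub by (auto simp: connect_def)
  show "psi st e' L = None \<and> psi (connect K I st e i) e' L = Some i \<and>
      dst I (e' L) i \<le> alpha st e' \<and> e' \<notin> active (connect K I st e i)"
    if "psi (connect K I st e i) e' L \<noteq> psi st e' L" for e' L
    using that active_psi[OF e(1)] by (auto simp: connect_def split: if_splits)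
  show "\<exists>L\<in>{1..K}. psi (connect K I st e i) e' L \<noteq> None"
    if "e' \<in> active st" "e' \<notin> active (connect K I st e i)" for e'
  proof -
    obtain L where "L \<in> {1..K}" "edist K I e i = dst I (e L) i" using edist_attained[OF K_pos] .
    then show ?thesis using that e(3) by (intro bexI[of _ L]) (auto simp: connect_def)
  qed
  show "alpha st e' \<le> dst I (e' L) i"
    if "e' \<in> hyperedges K I" "L \<in> {1..K}" "psi (connect K I st e i) e' L = None" for e' L
    using that e(2) by (intro unset) (auto simp: connect_def split: if_splits)
qed (use ev in \<open>auto simp: connect_def connect_event_def\<close>)

lemma greedy_inv_open:
  assumes ev: "open_event K I st i"
  shows "greedy_inv K I (open_facility K I st i) T (\<lambda>e L. if psi st e L = None then T else \<theta> e L)"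
proof (rule greedy_inv_event)
  show "psi st e L = None \<and> psi (open_facility K I st i) e L = Some i \<and>
      dst I (e L) i \<le> alpha st e \<and> e \<notin> active (open_facility K I st i)"
    if "psi (open_facility K I st i) e L \<noteq> psi st e L" for e L
    using that active_psi[of e L] by (auto simp: open_facility_def split: if_splits)
  show "\<exists>L\<in>{1..K}. psi (open_facility K I st i) e L \<noteq> None"
    if "e \<in> active st" "e \<notin> active (open_facility K I st i)" for e
  proof -
    obtain L where "L \<in> {1..K}" "edist K I e i = dst I (e L) i" using edist_attained[OF K_pos] .
    then show ?thesis using that active_sub by (intro bexI[of _ L]) (auto simp: open_facility_def)
  qed
  show set_i: "psi (open_facility K I st i) e L = Some i"
    if "e \<in> hyperedges K I" "L \<in> {1..K}" "psi st e L = None" "dst I (e L) i \<le> alpha st e" for e L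
    using that edist_le[OF that(2), of I e i] by (auto simp: open_facility_def)
  show "alpha st e \<le> dst I (e L) i"
    if "e \<in> hyperedges K I" "L \<in> {1..K}" "psi (open_facility K I st i) e L = None" for e L
    using that set_i[of e L] by (cases "psi st e L") (force simp: open_facility_def split: if_splits)+
qed (use ev in \<open>auto simp: open_facility_def open_event_def\<close>)

text \<open>Active \<open>alpha\<close> values and total bids vary continuously with the waiting
  time, so passing a distance to an open facility or an opening threshold would produce an event
  strictly before \<open>s\<close>. No location is assigned, so \<open>\<theta>\<close> stays the
  same.\<close>

lemma greedy_inv_wait:
  assumes "0 < s"
    and no_event: "\<And>r. 0 \<le> r \<Longrightarrow> r < s \<Longrightarrow>
      \<not> (\<exists>e i. connect_event K I (wait r st) e i) \<and> \<not> (\<exists>i. open_event K I (wait r st) i)"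
  shows "greedy_inv K I (wait s st) (T + s) \<theta>"
proof -
  have sel [simp]: "sol (wait r st) = sol st" "active (wait r st) = active st" "psi (wait r st) = psi st"
    "alpha (wait r st) e = (if e \<in> active st then T + r else alpha st e)" for r e
    using active_alpha by (auto simp: wait_def)
  have chances_eq: "chances K (wait r st) e = chances K st e" for r e
    by (simp add: chances_def)
  have psi_inactive: "e \<notin> active st" if "psi st e L = Some j" for e L j
    using active_psi[of e L] that by auto
  have unset': "alpha (wait s st) e \<le> dst I (e L) i"
    if e: "e \<in> hyperedges K I" "L \<in> {1..K}" "i \<in> sol st" "psi st e L = None" for e L i
  proof (cases "e \<in> active st")
    case True
    \<comment> \<open>Otherwise \<open>e\<close> would connect after waiting
      \<open>edist K I e i - T\<close>, which is nonnegative by \<open>unset\<close> at the closest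
      location.\<close>
    have "T + s \<le> edist K I e i"
    proof (rule ccontr)
      assume less: "\<not> ?thesis"
      obtain L where L: "L \<in> {1..K}" "edist K I e i = dst I (e L) i" using edist_attained[OF K_pos] .
      have "T \<le> edist K I e i"
        using unset[OF e(1) L(1) e(3)] L(2) active_psi[OF True] active_alpha[OF True] by simp
      moreover have "connect_event K I (wait (edist K I e i - T) st) e i"
        using True e(3) by (simp add: connect_event_def)
      ultimately show False using no_event[of "edist K I e i - T"] less by auto
    qed
    then show ?thesis using True edist_le[OF e(2), of I e i] by simp
  next
    case False
    then show ?thesis using unset[OF e] by simp
  qed
  have bid_eq: "total_bid K I (wait r st) i = (\<Sum>e\<in>hyperedges K I. tau I e * later_bid K I (wait r st) e i)"
    for r i
    using K_pos active_sub active_psi by (intro total_bid_eq_later_bids) auto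
  have bids': "total_bid K I (wait r st) i \<le> real K * fcost I i"
    if i: "i \<in> locs I" "i \<notin> sol st" and r: "0 \<le> r" "r \<le> s" for i r
  proof (rule ccontr)
    assume less: "\<not> ?thesis"
    have "continuous_on {0..r} (\<lambda>r. later_bid K I (wait r st) e i)" for e
      by (cases "e \<in> active st"; cases "chances K st e = {}")
        (auto simp: later_bid_eq chances_eq intro!: continuous_intros)
    then have "continuous_on {0..r} (\<lambda>r. total_bid K I (wait r st) i)"
      unfolding bid_eq by (intro continuous_intros)
    moreover have "(\<lambda>e. if e \<in> active st then alpha st e + 0 else alpha st e) = alpha st" by auto
    then have "wait 0 st = st" by (simp add: wait_def del: add_0_right)
    then have "total_bid K I (wait 0 st) i \<le> real K * fcost I i" using bids[OF i] by simp
    ultimately obtain x where x: "0 \<le> x" "x \<le> r" "total_bid K I (wait x st) i = real K * fcost I i"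
      using IVT'[of "\<lambda>r. total_bid K I (wait r st) i" 0 "real K * fcost I i" r] less r by auto
    \<comment> \<open>At \<open>r\<close> itself the bid exceeds the threshold strictly, so the
      crossing lies before \<open>s\<close> even when \<open>r = s\<close>.\<close>
    then have "x < s" using less r by (cases "x = r") auto
    moreover have "open_event K I (wait x st) i" using x(3) i by (simp add: open_event_def)
    ultimately show False using no_event[of x] x(1) by blast
  qed
  show ?thesis
  proof
    show "1 \<le> K" "lflp_instance K I" "0 \<le> T + s" "active (wait s st) \<subseteq> hyperedges K I"
      "sol (wait s st) \<subseteq> locs I"
      using K_pos inst T_nonneg \<open>0 < s\<close> active_sub sol_sub by auto
    show "alpha (wait s st) e = T + s" if "e \<in> active (wait s st)" for e
      using that by simp
    show "psi (wait s st) e L = None" if "e \<in> active (wait s st)" for e L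
      using that active_psi by simp
    show "0 \<le> alpha (wait s st) e \<and> alpha (wait s st) e \<le> T + s" if "e \<in> hyperedges K I" for e
      using alpha_range[OF that] T_nonneg \<open>0 < s\<close> by auto
    show "\<exists>L\<in>{1..K}. psi (wait s st) e L \<noteq> None" if "e \<in> hyperedges K I" "e \<notin> active (wait s st)" for e
      using inactive_psi that by simp
    show "alpha (wait s st) e \<le> dst I (e L) i"
      if "e \<in> hyperedges K I" "L \<in> {1..K}" "i \<in> sol (wait s st)" "psi (wait s st) e L = None" for e L i
      using unset' that by simp
    show "i \<in> sol (wait s st) \<and> dst I (e L) i \<le> alpha (wait s st) e \<and>
        alpha (wait s st) e \<le> \<theta> e L \<and> \<theta> e L \<le> T + s"
      if "e \<in> hyperedges K I" "L \<in> {1..K}" "psi (wait s st) e L = Some i" for e L i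
      using set[of e L i] that psi_inactive[of e L i] \<open>0 < s\<close> by auto
    show "alpha (wait s st) e' \<le> dst I (e' L') i"
      if "e \<in> hyperedges K I" "L \<in> {1..K}" "e' \<in> hyperedges K I" "L' \<in> {1..K}"
        "psi (wait s st) e L = Some i" "psi (wait s st) e' L' = Some i'" "\<theta> e L < \<theta> e' L'"
      for e L e' L' i i'
      using set_before[of e L e' L' i i'] that psi_inactive[of e' L' i'] by auto
    show "total_bid K I (wait s st) i \<le> real K * fcost I i" if "i \<in> locs I" "i \<notin> sol (wait s st)" for i
      using bids' that \<open>0 < s\<close> by simp
    show "(\<Sum>e\<in>{e\<in>hyperedges K I. psi (wait s st) e (Ls e) = None \<or> t \<le> \<theta> e (Ls e)}.
         tau I e * max (min (alpha (wait s st) e) t - dst I (e (Ls e)) i) 0) \<le> real K * fcost I i"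
      if Ls: "Ls \<in> hyperedges K I \<rightarrow> {1..K}" and i: "i \<in> locs I" and t: "0 \<le> t" "t \<le> T + s" for Ls i t
    proof (cases "t \<le> T")
      case True
      then have "min (alpha (wait s st) e) t = min (alpha st e) t" for e
        using active_alpha[of e] \<open>0 < s\<close> by auto
      then show ?thesis using past_bids[OF Ls i t(1) True] by simp
    next
      case False
      \<comment> \<open>Assigned pairs have \<open>\<theta> \<le> T < t\<close>, so only unset pairs
        remain in the sum.\<close>
      define E where "E = {e\<in>hyperedges K I. psi st e (Ls e) = None \<or> t \<le> \<theta> e (Ls e)}"
      have E: "e \<in> hyperedges K I" "Ls e \<in> {1..K}" "psi st e (Ls e) = None" if "e \<in> E" for e
      proof -
        show "e \<in> hyperedges K I" "Ls e \<in> {1..K}" using that Ls by (auto simp: E_def)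
        then show "psi st e (Ls e) = None"
          using that set[of e "Ls e"] False by (cases "psi st e (Ls e)") (force simp: E_def)+
      qed
      have "(\<Sum>e\<in>E. tau I e * max (min (alpha (wait s st) e) t - dst I (e (Ls e)) i) 0) \<le> real K * fcost I i"
      proof (cases "i \<in> sol st")
        case True
        have "max (min (alpha (wait s st) e) t - dst I (e (Ls e)) i) 0 = 0" if "e \<in> E" for e
          using unset'[OF E(1,2)[OF that] True E(3)[OF that]] by linarith
        then show ?thesis using fcost_nonneg[OF i] by simp
      next
        case notin: False
        \<comment> \<open>At time \<open>t\<close>, that is after waiting \<open>t - T\<close>, an
          active hyperedge has \<open>alpha\<close> equal to the cut \<open>t\<close>, so the
          truncated surplus is at most its actual bid then.\<close>
        have "max (min (alpha (wait s st) e) t - dst I (e (Ls e)) i) 0 \<le> later_bid K I (wait (t - T) st) e i"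
          if "e \<in> E" for e
        proof -
          have "min (alpha (wait s st) e) t \<le> alpha (wait (t - T) st) e" by simp
          then show ?thesis
            using later_bid_ge[of "Ls e" K "wait (t - T) st" e I i] E[OF that]
              later_bid_nonneg[of K I "wait (t - T) st" e i] by simp
        qed
        then have "(\<Sum>e\<in>E. tau I e * max (min (alpha (wait s st) e) t - dst I (e (Ls e)) i) 0)
            \<le> (\<Sum>e\<in>E. tau I e * later_bid K I (wait (t - T) st) e i)"
          using tau_nonneg E(1) by (intro sum_mono mult_left_mono) auto
        also have "\<dots> \<le> total_bid K I (wait (t - T) st) i"
          unfolding bid_eq using finite_hyperedges E(1) tau_nonneg later_bid_nonneg
          by (intro sum_mono2) auto
        also have "\<dots> \<le> real K * fcost I i"
          using False t i notin by (intro bids') auto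
        finally show ?thesis .
      qed
      then show ?thesis unfolding E_def by simp
    qed
    have "paid K I (wait s st) e = paid K I st e" for e
      unfolding paid_def using psi_inactive[of e] by (intro sum.cong) (auto split: option.splits)
    then show "real K * (\<Sum>i\<in>sol (wait s st). fcost I i)
        \<le> (\<Sum>e\<in>hyperedges K I. tau I e * paid K I (wait s st) e)"
      using payments by simp
  qed
qed

lemma greedy_inv_step:
  assumes "greedy_step K I st st'"
  shows "\<exists>T \<theta>. greedy_inv K I st' T \<theta>"
  using assms by cases (blast intro: greedy_inv_connect greedy_inv_open greedy_inv_wait)+

end

section \<open>The invariants along a run\<close>

lemma greedy_inv_init:
  assumes "1 \<le> K" and inst: "lflp_instance K I"
  shows "greedy_inv K I (init_state K I) 0 (\<lambda>_ _. 0)"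
proof -
  have d: "0 \<le> dst I x y" for x y
    using inst Metric_space.nonneg by (fastforce simp: lflp_instance_def)
  have f: "0 \<le> fcost I i" if "i \<in> locs I" for i
    using inst that by (simp add: lflp_instance_def)
  have "later_bid K I (init_state K I) e i = 0" for e i
    by (cases rule: later_bid_cases[of K I "init_state K I" e i])
      (use d[of "e _" i] in \<open>auto simp: init_state_def intro: antisym\<close>)
  then have "total_bid K I (init_state K I) i = 0" for i
    using \<open>1 \<le> K\<close> by (subst total_bid_eq_later_bids) (auto simp: init_state_def)
  then show ?thesis
    using assms d f by unfold_locales (auto simp: init_state_def paid_def)
qed

lemma greedy_inv_reachable:
  assumes "1 \<le> K" "lflp_instance K I" "(greedy_step K I)\<^sup>*\<^sup>* (init_state K I) st"
  shows "\<exists>T \<theta>. greedy_inv K I st T \<theta>"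
  using assms(3)
proof (induction rule: rtranclp_induct)
  case base
  then show ?case using greedy_inv_init[OF assms(1,2)] by blast
next
  case (step st st')
  then show ?case using greedy_inv.greedy_inv_step by blast
qed


section \<open>The approximation ratio\<close>

context greedy_inv
begin

lemma edist_nonneg: "0 \<le> edist K I e i"
  using edist_attained[OF K_pos, of I e i] dst_nonneg by metis

text \<open>Each of the \<open>K\<close> locations pays at most the surplus of \<open>alpha\<close>
  over the connection cost \<open>D\<close>, while openings collect \<open>K\<close> times the
  facility costs. The factor \<open>K\<close> cancels.\<close>

lemma cost_le_alpha:
  assumes fin: "active st = {}"
  shows "cost K I (sol st) \<le> (\<Sum>e\<in>hyperedges K I. tau I e * alpha st e)"
proof -
  define D where "D e = Min ((\<lambda>i. edist K I e i) ` sol st)" for e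
  have D_le: "D e \<le> dst I (e L) i" if "L \<in> {1..K}" "i \<in> sol st" for e L i
  proof -
    have "D e \<le> edist K I e i" unfolding D_def using that finite_sol by (intro Min_le) auto
    then show ?thesis using edist_le[OF that(1), of I e i] by linarith
  qed
  have paid_le: "paid K I st e \<le> real K * (alpha st e - D e)" if e: "e \<in> hyperedges K I" for e
  proof -
    obtain L0 i0 where L0: "L0 \<in> {1..K}" "psi st e L0 = Some i0"
      using inactive_psi[OF e] fin by auto
    \<comment> \<open>Some location is assigned at the end, so the surplus is nonnegative and also
      dominates the zero paid by unassigned locations.\<close>
    then have "D e \<le> alpha st e" using set[OF e L0] D_le[OF L0(1), of i0 e] by linarith
    then have "(case psi st e L of None \<Rightarrow> 0 | Some i \<Rightarrow> alpha st e - dst I (e L) i) \<le> alpha st e - D e"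
      if "L \<in> {1..K}" for L
      using set[OF e that] D_le[OF that, of _ e] by (auto split: option.splits)
    then show ?thesis
      unfolding paid_def using sum_bounded_above[of "{1..K}" _ "alpha st e - D e"] by simp
  qed
  have "real K * (\<Sum>i\<in>sol st. fcost I i) \<le> (\<Sum>e\<in>hyperedges K I. tau I e * (real K * (alpha st e - D e)))"
    using payments tau_nonneg paid_le by (blast intro: order_trans sum_mono mult_left_mono)
  also have "\<dots> = real K * (\<Sum>e\<in>hyperedges K I. tau I e * (alpha st e - D e))"
    by (simp add: sum_distrib_left algebra_simps)
  finally have "(\<Sum>i\<in>sol st. fcost I i) \<le> (\<Sum>e\<in>hyperedges K I. tau I e * (alpha st e - D e))"
    using K_pos by simp
  then show ?thesis
    by (simp add: cost_def D_def algebra_simps sum_subtractf)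
qed

text \<open>Each hyperedge is represented by its location \<open>Ls e\<close> closest to
  \<open>i\<close>, ordered by when that location was assigned. This turns the invariants into star
  data for \<open>i\<close>.\<close>

lemma star_le:
  assumes fin: "active st = {}" and i: "i \<in> locs I"
    and g: "Gamma_SFR K = ereal g" "1 \<le> g" and F: "F \<subseteq> hyperedges K I"
  shows "(\<Sum>e\<in>F. tau I e * alpha st e) \<le> g * (fcost I i + (\<Sum>e\<in>F. tau I e * edist K I e i))"
proof -
  define Ls where "Ls e = (SOME L. L \<in> {1..K} \<and> edist K I e i = dst I (e L) i)" for e
  have Ls: "Ls e \<in> {1..K}" "dst I (e (Ls e)) i = edist K I e i" for e
  proof -
    have "\<exists>L. L \<in> {1..K} \<and> edist K I e i = dst I (e L) i" using edist_attained[OF K_pos] by metis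
    then have "Ls e \<in> {1..K} \<and> edist K I e i = dst I (e (Ls e)) i" unfolding Ls_def by (rule someI_ex)
    then show "Ls e \<in> {1..K}" "dst I (e (Ls e)) i = edist K I e i" by auto
  qed
  define \<delta> where "\<delta> e = edist K I e i" for e
  \<comment> \<open>\<open>T + 1\<close> places locations that were never assigned after all
    assigned ones, without ordering them strictly among themselves.\<close>
  define \<Theta> where "\<Theta> e = (if psi st e (Ls e) = None then T + 1 else \<theta> e (Ls e))" for e
  \<comment> \<open>The remaining hyperedges of \<open>F\<close> have \<open>tau I e = 0\<close> or
    \<open>alpha st e \<le> \<delta> e\<close>; they are charged to their own connection cost at the
    end, using \<open>1 \<le> g\<close>.\<close>
  define S where "S = {e\<in>F. 0 < tau I e \<and> 0 < alpha st e \<and> \<delta> e \<le> alpha st e}"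
  have H: "e \<in> hyperedges K I" if "e \<in> S" for e using that F by (auto simp: S_def)
  have finF: "finite F" using F finite_hyperedges finite_subset by blast
  have "S \<subseteq> F" and finS: "finite S" using finF by (auto simp: S_def)
  have \<Theta>_le: "psi st e (Ls e) = None" if "e \<in> S" "T < \<Theta> e" for e
    using set[OF H[OF that(1)] Ls(1)] that(2) by (cases "psi st e (Ls e)") (force simp: \<Theta>_def)+
  have star: "star_data S (tau I) (alpha st) \<delta> \<Theta> 0 (real K * fcost I i)" if "S \<noteq> {}"
    unfolding star_data_def
  proof (intro conjI ballI allI impI)
    show "finite S" "S \<noteq> {}" by fact+
    fix e assume e: "e \<in> S"
    show "0 < tau I e" "0 < alpha st e" "\<delta> e \<le> alpha st e" using e by (auto simp: S_def)
    show "0 \<le> \<delta> e" by (simp add: \<delta>_def edist_nonneg)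
    show "alpha st e \<le> \<Theta> e"
      using set[OF H[OF e] Ls(1)] alpha_range[OF H[OF e]] by (force simp: \<Theta>_def)
    fix e' assume e': "e' \<in> S" and less: "\<Theta> e < \<Theta> e'"
    have "\<Theta> e' \<le> T + 1" using set[OF H[OF e'] Ls(1)] by (force simp: \<Theta>_def)
    then obtain j where j: "psi st e (Ls e) = Some j"
      using less by (cases "psi st e (Ls e)") (auto simp: \<Theta>_def)
    \<comment> \<open>When the location of \<open>e'\<close> was assigned, if ever, \<open>j\<close>
      was already open and had not captured it.\<close>
    have "alpha st e' \<le> dst I (e' (Ls e')) j"
    proof (cases "psi st e' (Ls e')")
      case None
      then show ?thesis using unset[OF H[OF e'] Ls(1)] set[OF H[OF e] Ls(1) j] by blast
    next
      case (Some j')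
      then show ?thesis
        using set_before[OF H[OF e] Ls(1) H[OF e'] Ls(1) j Some] less j by (simp add: \<Theta>_def)
    qed
    \<comment> \<open>The detour from \<open>e'\<close> to \<open>j\<close> passes through
      \<open>i\<close> and the location of \<open>e\<close>; the last leg is at most
      \<open>alpha st e\<close> because that location was assigned to \<open>j\<close>.\<close>
    moreover have "dst I (e' (Ls e')) j \<le> \<delta> e' + (\<delta> e + alpha st e)"
    proof -
      have x: "e (Ls e) \<in> locs I" "e' (Ls e') \<in> locs I" "j \<in> locs I"
        using H[OF e] H[OF e'] Ls(1)[of e] Ls(1)[of e'] set[OF H[OF e] Ls(1) j] sol_sub
        unfolding hyperedges_def by (auto dest: PiE_mem)
      have "dst I (e' (Ls e')) j \<le> dst I (e' (Ls e')) i + (dst I i (e (Ls e)) + dst I (e (Ls e)) j)"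
        using Metric_space.triangle[OF metric x(2) i x(3)] Metric_space.triangle[OF metric i x(1) x(3)]
        by linarith
      moreover have "dst I i (e (Ls e)) = \<delta> e" "dst I (e' (Ls e')) i = \<delta> e'"
        using Ls(2) Metric_space.commute[OF metric, of i "e (Ls e)"] by (simp_all add: \<delta>_def)
      moreover have "dst I (e (Ls e)) j \<le> alpha st e" using set[OF H[OF e] Ls(1) j] by simp
      ultimately show ?thesis by linarith
    qed
    ultimately show "alpha st e' \<le> alpha st e + \<delta> e + \<delta> e'" by linarith
  next
    fix t :: real assume "0 \<le> t"
    \<comment> \<open>\<open>past_bids\<close> covers times up to \<open>T\<close> only; since
      \<open>alpha\<close> never exceeds \<open>T\<close>, cutting there changes nothing.\<close>
    define u where "u = min t T"
    define E where "E = {e\<in>hyperedges K I. psi st e (Ls e) = None \<or> u \<le> \<theta> e (Ls e)}"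
    have eq: "min (alpha st e) t = min (alpha st e) u" if "e \<in> S" for e
      using alpha_range[OF H[OF that]] by (auto simp: u_def)
    have "(\<Sum>e\<in>{e\<in>S. t \<le> \<Theta> e}. tau I e * max (min (alpha st e) t - \<delta> e) 0)
        = (\<Sum>e\<in>{e\<in>S. t \<le> \<Theta> e}. tau I e * max (min (alpha st e) u - dst I (e (Ls e)) i) 0)"
      using eq by (intro sum.cong) (auto simp: \<delta>_def Ls(2))
    also have "\<dots> \<le> (\<Sum>e\<in>E. tau I e * max (min (alpha st e) u - dst I (e (Ls e)) i) 0)"
    proof (rule sum_mono2)
      show "finite E" using finite_hyperedges by (simp add: E_def)
      show "{e\<in>S. t \<le> \<Theta> e} \<subseteq> E"
        using H by (auto simp: E_def \<Theta>_def u_def)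
      show "0 \<le> tau I e * max (min (alpha st e) u - dst I (e (Ls e)) i) 0"
        if "e \<in> E - {e\<in>S. t \<le> \<Theta> e}" for e
        using that tau_nonneg by (auto simp: E_def)
    qed
    also have "\<dots> \<le> real K * fcost I i"
      unfolding E_def using Ls(1) i \<open>0 \<le> t\<close> T_nonneg by (intro past_bids) (auto simp: u_def)
    finally show "(\<Sum>e\<in>{e\<in>S. t \<le> \<Theta> e}. tau I e * max (min (alpha st e) t - \<delta> e) 0) \<le> real K * fcost I i" .
  qed
  have "(\<Sum>e\<in>S. tau I e * alpha st e) \<le> g * (fcost I i + (\<Sum>e\<in>S. tau I e * \<delta> e))"
  proof (cases "S = {}")
    case True
    then show ?thesis using g fcost_nonneg[OF i] by simp
  next
    case False
    then show ?thesis by (rule star_data_bound[OF star fcost_nonneg[OF i] g])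
  qed
  moreover have "(\<Sum>e\<in>F - S. tau I e * alpha st e) \<le> (\<Sum>e\<in>F - S. g * (tau I e * \<delta> e))"
  proof (rule sum_mono)
    fix e assume e: "e \<in> F - S"
    have tau: "0 \<le> tau I e" and \<alpha>: "0 \<le> alpha st e" using e F tau_nonneg alpha_range by auto
    have "0 \<le> \<delta> e" by (simp add: \<delta>_def edist_nonneg)
    then have "\<delta> e \<le> g * \<delta> e" using g mult_right_mono[of 1 g "\<delta> e"] by simp
    have "tau I e = 0 \<or> alpha st e \<le> \<delta> e"
      using e tau \<alpha> \<open>0 \<le> \<delta> e\<close> by (auto simp: S_def)
    then have "tau I e * alpha st e \<le> tau I e * (g * \<delta> e)"
      using tau \<open>\<delta> e \<le> g * \<delta> e\<close> by (auto intro: mult_left_mono)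
    then show "tau I e * alpha st e \<le> g * (tau I e * \<delta> e)" by (simp add: algebra_simps)
  qed
  ultimately show ?thesis
    using sum.subset_diff[OF \<open>S \<subseteq> F\<close> finF, of "\<lambda>e. tau I e * alpha st e"]
      sum.subset_diff[OF \<open>S \<subseteq> F\<close> finF, of "\<lambda>e. tau I e * \<delta> e"]
    by (simp add: \<delta>_def algebra_simps sum_distrib_left)
qed

text \<open>Assigning each hyperedge to a nearest facility of \<open>X\<close> splits the cost of
  \<open>X\<close> into stars, and the bounds for the stars add up.\<close>

lemma alpha_le_cost:
  assumes fin: "active st = {}" and X: "X \<subseteq> locs I" "X \<noteq> {}"
    and g: "Gamma_SFR K = ereal g" "1 \<le> g"
  shows "(\<Sum>e\<in>hyperedges K I. tau I e * alpha st e) \<le> g * cost K I X"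
proof -
  have finX: "finite X" using X finite_subset by blast
  have "\<exists>i\<in>X. Min ((\<lambda>i. edist K I e i) ` X) = edist K I e i" for e
  proof -
    have "Min ((\<lambda>i. edist K I e i) ` X) \<in> (\<lambda>i. edist K I e i) ` X" using finX X by (intro Min_in) auto
    then show ?thesis by auto
  qed
  then obtain c where c: "\<And>e. c e \<in> X" "\<And>e. Min ((\<lambda>i. edist K I e i) ` X) = edist K I e (c e)"
    by metis
  have group: "(\<Sum>i\<in>X. \<Sum>e\<in>{e\<in>hyperedges K I. c e = i}. h e) = sum h (hyperedges K I)"
    for h :: "(nat \<Rightarrow> nat) \<Rightarrow> real"
    using finX finite_hyperedges c(1) by (intro sum.group) auto
  have "(\<Sum>e\<in>hyperedges K I. tau I e * alpha st e)
      = (\<Sum>i\<in>X. \<Sum>e\<in>{e\<in>hyperedges K I. c e = i}. tau I e * alpha st e)"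
    by (simp only: group)
  also have "\<dots> \<le> (\<Sum>i\<in>X. g * (fcost I i + (\<Sum>e\<in>{e\<in>hyperedges K I. c e = i}. tau I e * edist K I e i)))"
    using X by (intro sum_mono star_le fin g) auto
  also have "\<dots> = g * ((\<Sum>i\<in>X. fcost I i)
      + (\<Sum>i\<in>X. \<Sum>e\<in>{e\<in>hyperedges K I. c e = i}. tau I e * edist K I e i))"
    by (simp only: sum_distrib_left[symmetric] sum.distrib)
  also have "(\<Sum>i\<in>X. \<Sum>e\<in>{e\<in>hyperedges K I. c e = i}. tau I e * edist K I e i)
      = (\<Sum>i\<in>X. \<Sum>e\<in>{e\<in>hyperedges K I. c e = i}. tau I e * edist K I e (c e))"
    by (intro sum.cong) auto
  also have "\<dots> = (\<Sum>e\<in>hyperedges K I. tau I e * edist K I e (c e))"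
    by (rule group)
  also have "g * ((\<Sum>i\<in>X. fcost I i) + (\<Sum>e\<in>hyperedges K I. tau I e * edist K I e (c e))) = g * cost K I X"
    by (simp add: cost_def c(2))
  finally show ?thesis .
qed

end

theorem theoremC1:
  fixes K :: nat
  assumes "1 \<le> K"
  shows "approx_ratio_at_most K (canonical_greedy K) (Gamma_SFR K)"
  unfolding approx_ratio_at_most_def
proof (intro allI impI)
  fix I SOL OPT
  assume inst: "lflp_instance K I" and alg: "canonical_greedy K I SOL" and opt: "is_optimal K I OPT"
  obtain g where g: "Gamma_SFR K = ereal g" "1 \<le> g" using Gamma_SFR_eq_real .
  obtain st where st: "(greedy_step K I)\<^sup>*\<^sup>* (init_state K I) st" "active st = {}" "sol st = SOL"
    using alg by (auto simp: canonical_greedy_def)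
  obtain T \<theta> where "greedy_inv K I st T \<theta>"
    using greedy_inv_reachable[OF assms inst st(1)] by blast
  then interpret greedy_inv K I st T \<theta> .
  have "OPT \<subseteq> locs I" "OPT \<noteq> {}"
    using opt by (auto simp: is_optimal_def is_arg_min_def)
  then have "(\<Sum>e\<in>hyperedges K I. tau I e * alpha st e) \<le> g * cost K I OPT"
    using g by (rule alpha_le_cost[OF st(2)])
  with cost_le_alpha[OF st(2)] have "cost K I SOL \<le> g * cost K I OPT"
    unfolding st(3) by (rule order_trans)
  then show "ereal (cost K I SOL) \<le> Gamma_SFR K * ereal (cost K I OPT)"
    using g by simp
qed

end
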